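(* In the setting described in the context (problem $\min F=f+r$, stochastic models satisfying (A1)–(A5), $\lambda\in(0,(\tau+\rho)^{-1})$, iteration count $T$), assume $F$ attains its minimum. For some $\alpha>0$, set $\eta_t=\frac{1}{\lambda^{-1}+\alpha^{-1}\sqrt{T+1}}$ for all indices $t=0,\ldots,T$. Then the random point $x_{t^*}$ returned by the stochastic model-based minimization algorithm satisfies $$\mathbb{E}\left[D_{\Phi}\left(\mathrm{prox}_{\lambda F}^\Phi (x_{t^*}),x_{t^*}\right)\right] \le \frac{\lambda^2( F_\lambda^\Phi(x_0) - \min F) + \frac{\lambda\mathsf{L}^2\alpha^2}{4} + \frac{\lambda(r(x_0)-\inf r)}{\lambda^{-1}-\rho+\alpha^{-1}} }{1 - \lambda (\tau + \rho)}\cdot\left(\frac{\lambda^{-1}-\rho}{T+1}+\frac{1}{\alpha\sqrt{T+1}}\right) .$$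
   Context: Legendre functions. $\Phi\colon\mathbb{R}^d\to\mathbb{R}\cup\{\infty\}$ is a Legendre function: it is proper, closed, strictly convex; $U:=\mathrm{int}(\mathrm{dom}\,\Phi)$ is nonempty; $\Phi$ is differentiable on $U$; and $\|\nabla\Phi(x_k)\|\to\infty$ for any sequence $\{x_k\}\subset U$ converging to a boundary point of $\mathrm{dom}\,\Phi$. Its Bregman divergence is $D_\Phi(y,x)=\Phi(y)-\Phi(x)-\langle\nabla\Phi(x),y-x\rangle$ for $x\in U$, $y\in\mathrm{dom}\,\Phi$. A function $g$ is $\rho$-weakly convex relative to $\Phi$ if $g+\rho\Phi$ is convex (for a function defined only on $U$: convex on $U$). Problem. $\min_x F(x):=f(x)+r(x)$, where $f\colon\mathbb{R}^d\to\mathbb{R}$ is locally Lipschitz, $r\colon\mathbb{R}^d\to\mathbb{R}\cup\{\infty\}$ is closed with convex domain, and $\mathrm{ri}(\mathrm{dom}\,r)\subseteq U$ and $\partial(r+\Phi)(x)=\emptyset$ for all $x\notin U$. Here $\partial$ is the limiting subdifferential: $v\in\partial g(x)$ iff there are $x_k\to x$ with $g(x_k)\to g(x)$ and $v_k\to v$ with $v_k\in\hat\partial g(x_k)$, where $\hat\partial g(x)=\{v: g(y)\ge g(x)+\langle v,y-x\rangle+o(\|y-x\|)\text{ as }y\to x\}$. Assumptions. $(\Omega,\mathcal{F},P)$ is a probability space and there are $\tau,\rho,\mathsf{L}>0$ such that: (A1) i.i.d. samples $\xi_0,\xi_1,\ldots\sim P$ can be generated. (A2) There is a measurable function $(x,y,\xi)\mapsto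 f_x(y,\xi)$ on $U\times U\times\Omega$ with $\mathbb{E}_\xi[f_x(x,\xi)]=f(x)$ for all $x\in U\cap\mathrm{dom}\,r$ and $\mathbb{E}_\xi[f_x(y,\xi)-f(y)]\le\tau D_\Phi(y,x)$ for all $x,y\in U\cap\mathrm{dom}\,r$. (A3) $f_x(\cdot,\xi)+r(\cdot)$ is $\rho$-weakly convex relative to $\Phi$ for all $x\in U\cap\mathrm{dom}\,r$ and a.e. $\xi\in\Omega$. (A4) There is a square integrable $L\colon\Omega\to\mathbb{R}_+$ with $\sqrt{\mathbb{E}_\xi[L(\xi)^2]}\le\mathsf{L}$ and $f_x(x,\xi)-f_x(y,\xi)\le L(\xi)\sqrt{D_\Phi(y,x)}$ for all $x,y\in U\cap\mathrm{dom}\,r$. (A5) For every $0<\lambda<(\tau+\rho)^{-1}$, $x\in U$ and a.e. $\xi$, the problems $\min_y\{F(y)+\frac1\lambda D_\Phi(y,x)\}$ and $\min_y\{f_x(y,\xi)+r(y)+\frac1\lambda D_\Phi(y,x)\}$ admit minimizers (which are unique and lie in $U$), varying measurably in $(x,\xi)\in U\times\Omega$. Minimization involving the models is over $y\in U$. Envelope and proximal map. $F_\lambda^\Phi(x):=\inf_y\{F(y)+\frac1\lambda D_\Phi(y,x)\}$ and $\mathrm{prox}_{\lambda F}^\Phi(x):=\mathrm{argmin}_y\{F(y)+\frac1\lambda D_\Phi(y,x)\}$. Algorithm (stochastic model-based minimization). Input: $x_0\in U\cap\mathrm{dom}\,r$, $0<\lambda<(\tau+\rho)^{-1}$, step-sizes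 $\eta_t\in(0,\lambda)$ nonincreasing in $t$, iteration count $T$. For $t=0,\ldots,T$: sample $\xi_t\sim P$ (independently) and set $x_{t+1}=\mathrm{argmin}_x\{f_{x_t}(x,\xi_t)+r(x)+\frac{1}{\eta_t}D_\Phi(x,x_t)\}$. Then sample $t^*\in\{0,\ldots,T\}$, independently of the $\xi_t$, with $\mathbb{P}(t^*=t)\propto\frac{\eta_t}{1-\eta_t\rho}$ and return $x_{t^*}$. The expectation is over all randomness. *)

theory Defs
  imports "HOL-Analysis.Analysis" "HOL-Probability.Probability"
begin

subsection \<open>Extended-valued functions\<close>

definition edom :: "('a \<Rightarrow> ereal) \<Rightarrow> 'a set" where
  "edom g = {x. g x < \<infinity>}"

definition proper_fun :: "('a \<Rightarrow> ereal) \<Rightarrow> bool" where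
  "proper_fun g \<longleftrightarrow> (\<forall>x. g x \<noteq> -\<infinity>) \<and> edom g \<noteq> {}"

text \<open>Closed means closed epigraph, i.e. lower semicontinuous.\<close>
definition closed_fun :: "('a::euclidean_space \<Rightarrow> ereal) \<Rightarrow> bool" where
  "closed_fun g \<longleftrightarrow> closed {(x, t::real). g x \<le> ereal t}"

text \<open>Only applied to functions that never take the value \<open>-\<infinity>\<close>, so the
  extended sums below are never of the ambiguous form \<open>\<infinity> + (-\<infinity>)\<close>.\<close>
definition econvex_on :: "'a::euclidean_space set \<Rightarrow> ('a \<Rightarrow> ereal) \<Rightarrow> bool" where
  "econvex_on S g \<longleftrightarrow> convex S \<and>
     (\<forall>x\<in>S. \<forall>y\<in>S. \<forall>u\<ge>0. \<forall>v\<ge>0. u + v = 1 \<longrightarrow>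
        g (u *\<^sub>R x + v *\<^sub>R y) \<le> ereal u * g x + ereal v * g y)"

definition strictly_econvex :: "('a::euclidean_space \<Rightarrow> ereal) \<Rightarrow> bool" where
  "strictly_econvex g \<longleftrightarrow>
     (\<forall>x\<in>edom g. \<forall>y\<in>edom g. \<forall>u>0. \<forall>v>0. x \<noteq> y \<longrightarrow> u + v = 1 \<longrightarrow>
        g (u *\<^sub>R x + v *\<^sub>R y) < ereal u * g x + ereal v * g y)"

text \<open>Gradient of the real-valued part of \<open>g\<close>; meaningful at interior points of the domain
  at which \<open>g\<close> is differentiable.\<close>
definition grad :: "('a::euclidean_space \<Rightarrow> ereal) \<Rightarrow> 'a \<Rightarrow> 'a" where
  "grad g x = (THE d. GDERIV (\<lambda>z. real_of_ereal (g z)) x :> d)"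

definition locally_lipschitz :: "('a::euclidean_space \<Rightarrow> real) \<Rightarrow> bool" where
  "locally_lipschitz f \<longleftrightarrow> (\<forall>x. \<exists>\<delta>>0. \<exists>K. K-lipschitz_on (cball x \<delta>) f)"

text \<open>Both subdifferentials are empty at points where the function is not finite, as is
  standard. The quantification over \<open>\<epsilon>\<close> spells out the \<open>o(\<parallel>y - x\<parallel>)\<close> term.\<close>
definition frechet_subdiff :: "('a::euclidean_space \<Rightarrow> ereal) \<Rightarrow> 'a \<Rightarrow> 'a set" where
  "frechet_subdiff g x = {v. \<bar>g x\<bar> \<noteq> \<infinity> \<and>
     (\<forall>\<epsilon>>0. \<forall>\<^sub>F y in nhds x. g y \<ge> g x + ereal (v \<bullet> (y - x) - \<epsilon> * norm (y - x)))}"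

definition limiting_subdiff :: "('a::euclidean_space \<Rightarrow> ereal) \<Rightarrow> 'a \<Rightarrow> 'a set" where
  "limiting_subdiff g x = {v. \<bar>g x\<bar> \<noteq> \<infinity> \<and>
     (\<exists>X V. X \<longlonglongrightarrow> x \<and> (\<lambda>k. g (X k)) \<longlonglongrightarrow> g x \<and> V \<longlonglongrightarrow> v \<and>
            (\<forall>k::nat. V k \<in> frechet_subdiff g (X k)))}"

definition unique_minimizer_on :: "'a set \<Rightarrow> ('a \<Rightarrow> ereal) \<Rightarrow> 'a \<Rightarrow> bool" where
  "unique_minimizer_on A h y \<longleftrightarrow> is_arg_min h (\<lambda>z. z \<in> A) y \<and>
     (\<forall>z. is_arg_min h (\<lambda>z. z \<in> A) z \<longrightarrow> z = y)"

subsection \<open>Legendre functions and Bregman divergence\<close>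

definition legendre :: "('a::euclidean_space \<Rightarrow> ereal) \<Rightarrow> bool" where
  "legendre \<Phi> \<longleftrightarrow>
     proper_fun \<Phi> \<and> closed_fun \<Phi> \<and> econvex_on UNIV \<Phi> \<and> strictly_econvex \<Phi> \<and>
     interior (edom \<Phi>) \<noteq> {} \<and>
     (\<forall>x\<in>interior (edom \<Phi>). (\<lambda>z. real_of_ereal (\<Phi> z)) differentiable (at x)) \<and>
     (\<forall>X x. (\<forall>k::nat. X k \<in> interior (edom \<Phi>)) \<longrightarrow> X \<longlonglongrightarrow> x \<longrightarrow> x \<in> frontier (edom \<Phi>) \<longrightarrow>
        filterlim (\<lambda>k. norm (grad \<Phi> (X k))) at_top sequentially)"

text \<open>\<open>bregman \<Phi> y x\<close> is \<open>D\<^sub>\<Phi>(y, x)\<close>, for \<open>x\<close> in the interior of the domain;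
  it equals \<open>\<infinity>\<close> when \<open>y\<close> lies outside the domain of \<open>\<Phi>\<close>.\<close>
definition bregman :: "('a::euclidean_space \<Rightarrow> ereal) \<Rightarrow> 'a \<Rightarrow> 'a \<Rightarrow> ereal" where
  "bregman \<Phi> y x = \<Phi> y - \<Phi> x - ereal (grad \<Phi> x \<bullet> (y - x))"

definition rel_weakly_convex_on ::
  "'a::euclidean_space set \<Rightarrow> real \<Rightarrow> ('a \<Rightarrow> ereal) \<Rightarrow> ('a \<Rightarrow> ereal) \<Rightarrow> bool" where
  "rel_weakly_convex_on S \<rho> \<Phi> g \<longleftrightarrow> econvex_on S (\<lambda>x. g x + ereal \<rho> * \<Phi> x)"

definition bregman_env ::
  "('a::euclidean_space \<Rightarrow> ereal) \<Rightarrow> real \<Rightarrow> ('a \<Rightarrow> ereal) \<Rightarrow> 'a \<Rightarrow> ereal" where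
  "bregman_env \<Phi> lam F x = (INF y. F y + ereal (1 / lam) * bregman \<Phi> y x)"

definition bregman_prox ::
  "('a::euclidean_space \<Rightarrow> ereal) \<Rightarrow> real \<Rightarrow> ('a \<Rightarrow> ereal) \<Rightarrow> 'a \<Rightarrow> 'a" where
  "bregman_prox \<Phi> lam F x = arg_min (\<lambda>y. F y + ereal (1 / lam) * bregman \<Phi> y x) (\<lambda>_. True)"

subsection \<open>Stochastic one-sided models\<close>

definition objective :: "('a \<Rightarrow> real) \<Rightarrow> ('a \<Rightarrow> ereal) \<Rightarrow> 'a \<Rightarrow> ereal" where
  "objective f r x = ereal (f x) + r x"

text \<open>\<open>fm x y \<xi>\<close> is the model value \<open>f\<^sub>x(y, \<xi>)\<close>. The map \<open>S \<nu>\<close> is the measurable solution map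
  \<open>(x, \<xi>) \<mapsto> argmin {f\<^sub>x(y, \<xi>) + r(y) + (1/\<nu>) D\<^sub>\<Phi>(y, x) : y \<in> U}\<close>. For each \<open>x\<close> it is determined by
  this only for almost every \<open>\<xi>\<close>, since minimizers need not exist for the remaining \<open>\<xi>\<close>.\<close>
locale stochastic_model_setting = prob_space P
  for P :: "'w measure" +
  fixes \<Phi> :: "'a::euclidean_space \<Rightarrow> ereal"
    and f :: "'a \<Rightarrow> real"
    and r :: "'a \<Rightarrow> ereal"
    and fm :: "'a \<Rightarrow> 'a \<Rightarrow> 'w \<Rightarrow> real"
    and S :: "real \<Rightarrow> 'a \<Rightarrow> 'w \<Rightarrow> 'a"
    and L :: "'w \<Rightarrow> real"
    and \<tau> \<rho> Lbar :: real
  assumes legendre: "legendre \<Phi>"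
    and f_lipschitz: "locally_lipschitz f"
    and r_not_MInf: "\<And>x. r x \<noteq> -\<infinity>"
    and r_closed: "closed_fun r"
    and r_dom_convex: "convex (edom r)"
    and r_dom_ri: "rel_interior (edom r) \<subseteq> interior (edom \<Phi>)"
    and r_subdiff_empty: "\<And>x. x \<notin> interior (edom \<Phi>) \<Longrightarrow> limiting_subdiff (\<lambda>y. r y + \<Phi> y) x = {}"
    and constants_pos: "\<tau> > 0" "\<rho> > 0" "Lbar > 0"
    and model_measurable:
      "(\<lambda>(x, y, \<xi>). fm x y \<xi>) \<in> borel_measurable
         (restrict_space borel (interior (edom \<Phi>)) \<Otimes>\<^sub>M
            (restrict_space borel (interior (edom \<Phi>)) \<Otimes>\<^sub>M P))"
    and model_unbiased:
      "\<And>x. x \<in> interior (edom \<Phi>) \<inter> edom r \<Longrightarrow>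
         integrable P (fm x x) \<and> (\<integral>\<xi>. fm x x \<xi> \<partial>P) = f x"
    and model_one_sided:
      "\<And>x y. x \<in> interior (edom \<Phi>) \<inter> edom r \<Longrightarrow> y \<in> interior (edom \<Phi>) \<inter> edom r \<Longrightarrow>
         integrable P (\<lambda>\<xi>. fm x y \<xi> - f y) \<and>
         ereal (\<integral>\<xi>. (fm x y \<xi> - f y) \<partial>P) \<le> ereal \<tau> * bregman \<Phi> y x"
    and model_weakly_convex:
      "\<And>x. x \<in> interior (edom \<Phi>) \<inter> edom r \<Longrightarrow>
         AE \<xi> in P. rel_weakly_convex_on (interior (edom \<Phi>)) \<rho> \<Phi> (\<lambda>y. ereal (fm x y \<xi>) + r y)"
    and L_measurable: "L \<in> borel_measurable P"
    and L_nonneg: "\<And>\<xi>. \<xi> \<in> space P \<Longrightarrow> L \<xi> \<ge> 0"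
    and L_square_integrable: "integrable P (\<lambda>\<xi>. (L \<xi>)\<^sup>2)"
    and L_bound: "sqrt (\<integral>\<xi>. (L \<xi>)\<^sup>2 \<partial>P) \<le> Lbar"
    and model_lipschitz:
      "\<And>x y \<xi>. x \<in> interior (edom \<Phi>) \<inter> edom r \<Longrightarrow> y \<in> interior (edom \<Phi>) \<inter> edom r \<Longrightarrow>
         \<xi> \<in> space P \<Longrightarrow> fm x x \<xi> - fm x y \<xi> \<le> L \<xi> * sqrt (real_of_ereal (bregman \<Phi> y x))"
    and prox_unique:
      "\<And>\<nu> x. 0 < \<nu> \<Longrightarrow> \<nu> < 1 / (\<tau> + \<rho>) \<Longrightarrow> x \<in> interior (edom \<Phi>) \<Longrightarrow>
         \<exists>y\<in>interior (edom \<Phi>).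
           unique_minimizer_on UNIV (\<lambda>z. objective f r z + ereal (1 / \<nu>) * bregman \<Phi> z x) y"
    and prox_measurable:
      "\<And>\<nu>. 0 < \<nu> \<Longrightarrow> \<nu> < 1 / (\<tau> + \<rho>) \<Longrightarrow>
         bregman_prox \<Phi> \<nu> (objective f r) \<in> restrict_space borel (interior (edom \<Phi>)) \<rightarrow>\<^sub>M borel"
    and model_argmin_unique:
      "\<And>\<nu> x. 0 < \<nu> \<Longrightarrow> \<nu> < 1 / (\<tau> + \<rho>) \<Longrightarrow> x \<in> interior (edom \<Phi>) \<Longrightarrow>
         AE \<xi> in P. unique_minimizer_on (interior (edom \<Phi>))
           (\<lambda>y. ereal (fm x y \<xi>) + r y + ereal (1 / \<nu>) * bregman \<Phi> y x) (S \<nu> x \<xi>)"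
    and model_argmin_measurable:
      "\<And>\<nu>. 0 < \<nu> \<Longrightarrow> \<nu> < 1 / (\<tau> + \<rho>) \<Longrightarrow>
         (\<lambda>(x, \<xi>). S \<nu> x \<xi>) \<in> restrict_space borel (interior (edom \<Phi>)) \<Otimes>\<^sub>M P
           \<rightarrow>\<^sub>M restrict_space borel (interior (edom \<Phi>))"

subsection \<open>Stochastic model-based minimization\<close>

primrec model_iterate ::
  "(real \<Rightarrow> 'a \<Rightarrow> 'w \<Rightarrow> 'a) \<Rightarrow> (nat \<Rightarrow> real) \<Rightarrow> 'a \<Rightarrow> (nat \<Rightarrow> 'w) \<Rightarrow> nat \<Rightarrow> 'a" where
  "model_iterate S \<eta> x\<^sub>0 w 0 = x\<^sub>0"
| "model_iterate S \<eta> x\<^sub>0 w (Suc t) = S (\<eta> t) (model_iterate S \<eta> x\<^sub>0 w t) (w t)"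

text \<open>The randomness of a run on a sample space \<open>M\<close>: i.i.d. samples \<open>\<xi> 0, \<dots>, \<xi> T\<close> with law \<open>P\<close>,
  and an index \<open>tstar\<close> independent of all of them with the prescribed law on \<open>{0..T}\<close>.\<close>
definition algorithm_randomness ::
  "'s measure \<Rightarrow> 'w measure \<Rightarrow> nat \<Rightarrow> real \<Rightarrow> (nat \<Rightarrow> real) \<Rightarrow> (nat \<Rightarrow> 's \<Rightarrow> 'w) \<Rightarrow> ('s \<Rightarrow> nat) \<Rightarrow> bool"
where
  "algorithm_randomness M P T \<rho> \<eta> \<xi> tstar \<longleftrightarrow>
     prob_space M \<and>
     prob_space.indep_vars M (\<lambda>_. P) \<xi> {..T} \<and>
     (\<forall>t\<le>T. distr M P (\<xi> t) = P) \<and>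
     tstar \<in> M \<rightarrow>\<^sub>M count_space UNIV \<and>
     prob_space.indep_set M
       (sets (vimage_algebra (space M) (\<lambda>\<omega>. \<lambda>t\<in>{..T}. \<xi> t \<omega>) (\<Pi>\<^sub>M t\<in>{..T}. P)))
       (sets (vimage_algebra (space M) tstar (count_space UNIV))) \<and>
     (\<forall>t\<le>T. measure M {\<omega>\<in>space M. tstar \<omega> = t} =
        (\<eta> t / (1 - \<eta> t * \<rho>)) / (\<Sum>s\<le>T. \<eta> s / (1 - \<eta> s * \<rho>)))"

definition returned_point ::
  "(real \<Rightarrow> 'a \<Rightarrow> 'w \<Rightarrow> 'a) \<Rightarrow> (nat \<Rightarrow> real) \<Rightarrow> 'a \<Rightarrow> (nat \<Rightarrow> 's \<Rightarrow> 'w) \<Rightarrow> ('s \<Rightarrow> nat) \<Rightarrow> 's \<Rightarrow> 'a" where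
  "returned_point S \<eta> x\<^sub>0 \<xi> tstar \<omega> = model_iterate S \<eta> x\<^sub>0 (\<lambda>t. \<xi> t \<omega>) (tstar \<omega>)"

end

theory Submission
  imports Defs
begin

text \<open>
  The proof is a drift argument for the potential
  \<open>(F\<^sub>\<lambda>(x) - min F) + (\<gamma>/\<lambda>) (r(x) - inf r)\<close>, where \<open>F\<^sub>\<lambda>\<close> is the Bregman envelope and
  \<open>\<gamma> = \<eta> / (1 - \<eta> \<rho>)\<close> for the constant step-size \<open>\<eta>\<close>. In expectation, one step of the algorithm from
  \<open>x\<close> decreases it by a multiple of \<open>D(p, x)\<close>, where \<open>p\<close> is the proximal point of \<open>x\<close>, up to an
  additive error \<open>(\<gamma>/\<lambda>) \<eta> Lbar\<^sup>2 / 4\<close> (\<open>step_drift\<close>). The reason is a comparison of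
  two minimization problems with the same competitor: the step minimizes a sampled model that is convex up to
  \<open>\<rho> \<Phi>\<close>, so the new iterate \<open>z\<close> satisfies a three-point inequality against \<open>p\<close>
  (\<open>bregman_three_point\<close>), which bounds \<open>D(p, z)\<close>; and \<open>p\<close> is admissible in the envelope
  at \<open>z\<close>, so a bound on \<open>D(p, z)\<close> is a bound on the envelope at \<open>z\<close>. The gain comes from
  \<open>F(p) + D(p, x)/\<lambda> \<le> F(x)\<close>, which beats the model error \<open>\<tau> D(p, x)\<close> and the convexity defect
  \<open>\<rho> D(p, x)\<close> because \<open>1/\<lambda> > \<tau> + \<rho>\<close>.

  The potential is nonnegative, so summing the drift over a run bounds the sum of the expected divergences
  (\<open>sum_divergence_le\<close>). The constant step-size makes the law of the returned index uniform, and
  independence identifies the expected divergence at the returned point with the average of these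
  expectations (\<open>nn_integral_random_index\<close>). Inserting the chosen \<open>\<eta>\<close> gives the stated
  rate (\<open>rate_arithmetic\<close>).
\<close>

section \<open>Gradients and Bregman divergences of Legendre functions\<close>

lemma GDERIV_directional:
  fixes p :: "'a::euclidean_space \<Rightarrow> real"
  assumes "GDERIV p z :> d"
  shows "((\<lambda>s. (p (z + s *\<^sub>R v) - p z) / s) \<longlongrightarrow> d \<bullet> v) (at 0)"
proof -
  have "((\<lambda>s::real. p (z + s *\<^sub>R v)) has_derivative (\<lambda>s. (s *\<^sub>R v) \<bullet> d)) (at 0)"
    by (rule has_derivative_compose[where g = p and f = "\<lambda>s. z + s *\<^sub>R v"])
      (use assms in \<open>auto simp: gderiv_def intro!: derivative_eq_intros\<close>)
  then have "((\<lambda>s. p (z + s *\<^sub>R v)) has_field_derivative v \<bullet> d) (at 0)"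
    by (rule has_derivative_imp_has_field_derivative) simp
  then show ?thesis
    by (simp add: has_field_derivative_iff inner_commute)
qed

text \<open>Every first-order argument below reduces to this one-dimensional fact: if a differentiable function
  stays below an affine one along a segment that starts at \<open>z\<close>, with equality at \<open>z\<close>, then its
  directional derivative at \<open>z\<close> is at most the affine slope. It replaces subdifferential calculus both in
  the gradient inequality and in the optimality condition of the proximal subproblem.\<close>
lemma GDERIV_slope_le:
  fixes p :: "'a::euclidean_space \<Rightarrow> real"
  assumes "GDERIV p z :> d"
    and "\<And>s. 0 < s \<Longrightarrow> s < 1 \<Longrightarrow> p (z + s *\<^sub>R v) \<le> p z + s * c"
  shows "d \<bullet> v \<le> c"
proof -
  have "((\<lambda>s. (p (z + s *\<^sub>R v) - p z) / s) \<longlongrightarrow> d \<bullet> v) (at_right 0)"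
    using GDERIV_directional[OF assms(1)] by (rule tendsto_mono[OF at_le, rotated]) simp
  moreover have "\<forall>\<^sub>F s in at_right 0. (p (z + s *\<^sub>R v) - p z) / s \<le> c"
    unfolding eventually_at_right_field
    by (intro exI[of _ 1]) (use assms(2) in \<open>auto simp: divide_simps algebra_simps\<close>)
  ultimately show ?thesis
    by (rule tendsto_upperbound) simp
qed

lemma legendre_finite:
  assumes "legendre \<Phi>" "x \<in> edom \<Phi>"
  shows "\<Phi> x = ereal (real_of_ereal (\<Phi> x))"
  using assms by (cases "\<Phi> x") (auto simp: legendre_def proper_fun_def edom_def)

text \<open>The Riesz vector of the derivative is unique, so the definite description in the definition
  of the gradient really denotes it.\<close>
lemma GDERIV_grad:
  assumes "legendre \<Phi>" "x \<in> interior (edom \<Phi>)"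
  shows "GDERIV (\<lambda>z. real_of_ereal (\<Phi> z)) x :> grad \<Phi> x"
proof -
  obtain A where A: "((\<lambda>z. real_of_ereal (\<Phi> z)) has_derivative A) (at x)"
    using assms unfolding legendre_def differentiable_def by blast
  define d where "d = (\<Sum>b\<in>Basis. A b *\<^sub>R b)"
  have "A h = h \<bullet> d" for h
  proof -
    have "A h = A (\<Sum>b\<in>Basis. (h \<bullet> b) *\<^sub>R b)" by (simp add: euclidean_representation)
    also have "\<dots> = (\<Sum>b\<in>Basis. (h \<bullet> b) * A b)"
      using has_derivative_linear[OF A] by (simp add: linear_sum linear_cmul)
    also have "\<dots> = h \<bullet> d" by (simp add: d_def inner_sum_right mult.commute)
    finally show ?thesis .
  qed
  then have "A = (\<lambda>h. h \<bullet> d)" by (rule ext)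
  with A have d: "GDERIV (\<lambda>z. real_of_ereal (\<Phi> z)) x :> d"
    by (simp add: gderiv_def)
  have "e = d" if "GDERIV (\<lambda>z. real_of_ereal (\<Phi> z)) x :> e" for e
  proof -
    have "(\<lambda>h. h \<bullet> e) = (\<lambda>h. h \<bullet> d)"
      using that d unfolding gderiv_def by (rule has_derivative_unique)
    then have "(e - d) \<bullet> e = (e - d) \<bullet> d" by (rule fun_cong)
    then have "(e - d) \<bullet> (e - d) = 0" by (simp add: inner_diff_right)
    then show ?thesis by simp
  qed
  with d show ?thesis unfolding grad_def by (rule theI)
qed

text \<open>On the domain of \<open>\<Phi>\<close> the divergence is finite; the real-valued version allows ordinary
  arithmetic there.\<close>
definition rbregman :: "('a::euclidean_space \<Rightarrow> ereal) \<Rightarrow> 'a \<Rightarrow> 'a \<Rightarrow> real" where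
  "rbregman \<Phi> y x = real_of_ereal (\<Phi> y) - real_of_ereal (\<Phi> x) - grad \<Phi> x \<bullet> (y - x)"

lemma bregman_eq:
  assumes "legendre \<Phi>" "y \<in> edom \<Phi>" "x \<in> edom \<Phi>"
  shows "bregman \<Phi> y x = ereal (rbregman \<Phi> y x)"
  unfolding bregman_def rbregman_def
  by (subst (1 2) legendre_finite[OF assms(1)]) (use assms in auto)

lemma rbregman_self [simp]: "rbregman \<Phi> x x = 0"
  by (simp add: rbregman_def)

lemma convex_edom: "legendre \<Phi> \<Longrightarrow> convex (edom \<Phi>)"
proof -
  assume L: "legendre \<Phi>"
  show ?thesis
  proof (rule convexI)
    fix x y and u v :: real
    assume *: "x \<in> edom \<Phi>" "y \<in> edom \<Phi>" "0 \<le> u" "0 \<le> v" "u + v = 1"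
    then have "\<Phi> (u *\<^sub>R x + v *\<^sub>R y) \<le> ereal u * \<Phi> x + ereal v * \<Phi> y"
      using L by (auto simp: legendre_def econvex_on_def)
    also have "\<dots> < \<infinity>"
      by (subst (1 2) legendre_finite[OF L]) (use * in auto)
    finally show "u *\<^sub>R x + v *\<^sub>R y \<in> edom \<Phi>" by (simp add: edom_def)
  qed
qed

lemma rbregman_nonneg:
  assumes L: "legendre \<Phi>" and x: "x \<in> interior (edom \<Phi>)" and y: "y \<in> edom \<Phi>"
  shows "0 \<le> rbregman \<Phi> y x"
proof -
  let ?p = "\<lambda>z. real_of_ereal (\<Phi> z)"
  have x': "x \<in> edom \<Phi>" using x interior_subset by auto
  have "grad \<Phi> x \<bullet> (y - x) \<le> ?p y - ?p x"
  proof (rule GDERIV_slope_le[OF GDERIV_grad[OF L x]])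
    fix s :: real assume s: "0 < s" "s < 1"
    have eq: "x + s *\<^sub>R (y - x) = (1 - s) *\<^sub>R x + s *\<^sub>R y" by (simp add: algebra_simps)
    have mem: "x + s *\<^sub>R (y - x) \<in> edom \<Phi>"
      unfolding eq using convexD[OF convex_edom[OF L] x' y] s by simp
    have "\<Phi> (x + s *\<^sub>R (y - x)) \<le> ereal (1 - s) * \<Phi> x + ereal s * \<Phi> y"
      unfolding eq using L s by (auto simp: legendre_def econvex_on_def)
    then have "?p (x + s *\<^sub>R (y - x)) \<le> (1 - s) * ?p x + s * ?p y"
      by (subst (asm) (1 2 3) legendre_finite[OF L]) (use x' y mem in auto)
    then show "?p (x + s *\<^sub>R (y - x)) \<le> ?p x + s * (?p y - ?p x)"
      by (simp add: algebra_simps)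
  qed
  then show ?thesis by (simp add: rbregman_def)
qed

lemma bregman_nonneg:
  assumes L: "legendre \<Phi>" and x: "x \<in> interior (edom \<Phi>)"
  shows "0 \<le> bregman \<Phi> y x"
proof (cases "y \<in> edom \<Phi>")
  case True
  then show ?thesis
    using bregman_eq[OF L True subsetD[OF interior_subset x]] rbregman_nonneg[OF L x True] by simp
next
  case False
  then have y: "\<Phi> y = \<infinity>" by (auto simp: edom_def)
  obtain p where "\<Phi> x = ereal p"
    using legendre_finite[OF L subsetD[OF interior_subset x]] ..
  with y show ?thesis by (simp add: bregman_def)
qed

text \<open>Optimality of a Bregman proximal point \<open>z\<close>, in quantitative form. The objective
  \<open>g + \<kappa> D(\<cdot>, x)\<close> splits into the convex function \<open>g + \<rho> \<Phi>\<close>, the differentiable function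
  \<open>(\<kappa> - \<rho>) \<Phi>\<close> and an affine one. Comparing \<open>z\<close> with the points \<open>z + s (y - z)\<close> and
  letting \<open>s\<close> tend to \<open>0\<close> bounds the derivative of \<open>- (\<kappa> - \<rho>) \<Phi>\<close> at \<open>z\<close> in direction
  \<open>y - z\<close>; the remainder \<open>(\<kappa> - \<rho>) D(y, z)\<close> is what this first-order expansion misses.\<close>
lemma bregman_three_point:
  assumes L: "legendre \<Phi>"
    and x: "x \<in> interior (edom \<Phi>)"
    and z: "is_arg_min (\<lambda>w. g w + ereal \<kappa> * bregman \<Phi> w x) (\<lambda>w. w \<in> interior (edom \<Phi>)) z"
    and y: "y \<in> interior (edom \<Phi>)" "g y < \<infinity>" and gz: "g z < \<infinity>"
    and g: "\<And>w. g w \<noteq> -\<infinity>"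
    and cvx: "rel_weakly_convex_on (interior (edom \<Phi>)) \<rho> \<Phi> g"
  shows "real_of_ereal (g z) + \<kappa> * rbregman \<Phi> z x + (\<kappa> - \<rho>) * rbregman \<Phi> y z
           \<le> real_of_ereal (g y) + \<kappa> * rbregman \<Phi> y x"
proof -
  let ?U = "interior (edom \<Phi>)" and ?p = "\<lambda>w. real_of_ereal (\<Phi> w)"
  have zU: "z \<in> ?U" using z by (simp add: is_arg_min_def)
  have U: "w \<in> edom \<Phi>" if "w \<in> ?U" for w using that interior_subset by auto
  have Phi: "\<exists>q. \<Phi> w = ereal q" if "w \<in> ?U" for w using legendre_finite[OF L U[OF that]] by blast
  have gfin: "\<exists>q. g w = ereal q" if "g w < \<infinity>" for w using that g[of w] by (cases "g w") auto
  obtain pz py where p: "\<Phi> z = ereal pz" "\<Phi> y = ereal py"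
    using Phi zU y(1) by meson
  obtain a b where ab: "g z = ereal a" "g y = ereal b"
    using gfin gz y(2) by meson
  have cU: "convex ?U" using convex_edom[OF L] by (rule convex_interior)
  define v where "v = y - z"
  define c where "c = (b + \<rho> * py) - (a + \<rho> * pz) - \<kappa> * (grad \<Phi> x \<bullet> v)"
  have "(- (\<kappa> - \<rho>)) *\<^sub>R grad \<Phi> z \<bullet> v \<le> c"
  proof (rule GDERIV_slope_le[where p = "\<lambda>w. - (\<kappa> - \<rho>) * ?p w"])
    show "GDERIV (\<lambda>w. - (\<kappa> - \<rho>) * ?p w) z :> - (\<kappa> - \<rho>) *\<^sub>R grad \<Phi> z"
      using GDERIV_mult[OF GDERIV_const GDERIV_grad[OF L zU], of "- (\<kappa> - \<rho>)"] by simp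
  next
    fix s :: real assume s: "0 < s" "s < 1"
    define w where "w = z + s *\<^sub>R v"
    have w: "w = (1 - s) *\<^sub>R z + s *\<^sub>R y" by (simp add: w_def v_def algebra_simps)
    have wU: "w \<in> ?U" unfolding w using convexD[OF cU zU y(1)] s by simp
    obtain pw where pw: "\<Phi> w = ereal pw" using Phi wU by blast
    have "g w + ereal \<rho> * \<Phi> w
        \<le> ereal (1 - s) * (g z + ereal \<rho> * \<Phi> z) + ereal s * (g y + ereal \<rho> * \<Phi> y)"
      using cvx s zU y(1) unfolding rel_weakly_convex_on_def econvex_on_def w by simp
    then have conv: "g w + ereal (\<rho> * pw)
        \<le> ereal ((1 - s) * (a + \<rho> * pz) + s * (b + \<rho> * py))"
      by (simp add: p ab pw)
    then have "g w < \<infinity>" by (cases "g w") auto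
    then obtain gw where gw: "g w = ereal gw" using gfin by blast
    from conv have r1: "gw + \<rho> * pw \<le> (1 - s) * (a + \<rho> * pz) + s * (b + \<rho> * py)"
      by (simp add: gw)
    have "\<not> g w + ereal \<kappa> * bregman \<Phi> w x < g z + ereal \<kappa> * bregman \<Phi> z x"
      using z wU by (simp add: is_arg_min_def)
    then have r2: "a + \<kappa> * rbregman \<Phi> z x \<le> gw + \<kappa> * rbregman \<Phi> w x"
      by (simp add: bregman_eq[OF L U U] wU zU x gw ab)
    have r3: "\<kappa> * rbregman \<Phi> w x - \<kappa> * rbregman \<Phi> z x
        = \<kappa> * pw - \<kappa> * pz - s * (\<kappa> * (grad \<Phi> x \<bullet> v))"
      unfolding rbregman_def pw p by (simp add: w_def algebra_simps)
    show "- (\<kappa> - \<rho>) * ?p (z + s *\<^sub>R v) \<le> - (\<kappa> - \<rho>) * ?p z + s * c"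
      using r1 r2 r3 unfolding c_def w_def[symmetric] pw p by (simp add: algebra_simps)
  qed
  then show ?thesis
    unfolding rbregman_def p ab by (simp add: c_def v_def algebra_simps)
qed

section \<open>Measurability\<close>

text \<open>A closed epigraph has closed slices at every real height, so \<open>g\<close> is lower semicontinuous and its
  sublevel sets are closed; the level \<open>-\<infinity>\<close> is the intersection of countably many real ones.\<close>
lemma closed_fun_borel_measurable:
  fixes g :: "'a::euclidean_space \<Rightarrow> ereal"
  assumes "closed_fun g"
  shows "g \<in> borel_measurable borel"
  unfolding borel_measurable_iff_Iic_ereal
proof
  fix a
  have c: "closed {x. g x \<le> ereal t}" for t
  proof -
    have "closed ((\<lambda>x. (x, t)) -` {(x, t::real). g x \<le> ereal t})"
      using assms unfolding closed_fun_def
      by (intro continuous_closed_vimage) (auto intro!: continuous_intros)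
    then show ?thesis by (simp add: vimage_def)
  qed
  show "g -` {..a} \<inter> space borel \<in> sets borel"
  proof (cases a)
    case (real t)
    then show ?thesis using c[of t] by (simp add: vimage_def)
  next
    case PInf
    then have "g -` {..a} \<inter> space borel = UNIV" by auto
    then show ?thesis by simp
  next
    case MInf
    then have "g -` {..a} \<inter> space borel = (\<Inter>n::nat. {x. g x \<le> ereal (- real n)})"
    proof (intro set_eqI iffI)
      fix x assume x: "x \<in> (\<Inter>n::nat. {x. g x \<le> ereal (- real n)})"
      have "g x = -\<infinity>"
      proof (rule ccontr)
        assume *: "g x \<noteq> -\<infinity>"
        moreover have "g x \<le> ereal (- real 0)" using x by blast
        ultimately obtain q where q: "g x = ereal q" by (cases "g x") auto
        obtain n :: nat where "real n > - q" using reals_Archimedean2 by blast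
        moreover have "g x \<le> ereal (- real n)" using x by blast
        ultimately show False using q by simp
      qed
      then show "x \<in> g -` {..a} \<inter> space borel" using MInf by simp
    qed (auto simp: MInf)
    then show ?thesis using c by (auto intro!: borel_closed)
  qed
qed

lemma locally_lipschitz_continuous:
  assumes "locally_lipschitz f"
  shows "continuous_on UNIV f"
proof -
  have "isCont f x" for x
  proof -
    obtain d K where "d > 0" "K-lipschitz_on (cball x d) f"
      using assms unfolding locally_lipschitz_def by blast
    then have "continuous_on (ball x d) f" "x \<in> ball x d"
      using lipschitz_on_continuous_on continuous_on_subset ball_subset_cball by (blast, simp)
    then show ?thesis using continuous_on_eq_continuous_at[OF open_ball] by blast
  qed
  then show ?thesis by (simp add: continuous_at_imp_continuous_on)
qed

text \<open>Each coordinate of the gradient is the pointwise limit of difference quotients of the Borel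
  function \<open>\<Phi>\<close>.\<close>
lemma measurable_grad:
  assumes L: "legendre \<Phi>"
  shows "grad \<Phi> \<in> borel_measurable (restrict_space borel (interior (edom \<Phi>)))"
proof (subst borel_measurable_euclidean_space, intro ballI)
  fix b :: 'a assume "b \<in> Basis"
  let ?p = "\<lambda>z. real_of_ereal (\<Phi> z)"
  have [measurable]: "\<Phi> \<in> borel_measurable borel"
    using L by (intro closed_fun_borel_measurable) (simp add: legendre_def)
  show "(\<lambda>x. grad \<Phi> x \<bullet> b) \<in> borel_measurable (restrict_space borel (interior (edom \<Phi>)))"
  proof (rule borel_measurable_LIMSEQ_real)
    fix x assume "x \<in> space (restrict_space borel (interior (edom \<Phi>)))"
    then have x: "x \<in> interior (edom \<Phi>)" by (simp add: space_restrict_space)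
    have "filterlim (\<lambda>n. inverse (real (Suc n))) (at 0) sequentially"
      unfolding filterlim_at using LIMSEQ_inverse_real_of_nat by simp
    with GDERIV_directional[OF GDERIV_grad[OF L x]]
    show "(\<lambda>n. (?p (x + inverse (real (Suc n)) *\<^sub>R b) - ?p x) / inverse (real (Suc n)))
            \<longlonglongrightarrow> grad \<Phi> x \<bullet> b"
      by (rule filterlim_compose)
  next
    fix n
    show "(\<lambda>x. (?p (x + inverse (real (Suc n)) *\<^sub>R b) - ?p x) / inverse (real (Suc n)))
      \<in> borel_measurable (restrict_space borel (interior (edom \<Phi>)))"
      by (rule measurable_restrict_space1) measurable
  qed
qed

lemma measurable_rbregman:
  assumes L: "legendre \<Phi>"
    and q: "q \<in> borel_measurable (restrict_space borel (interior (edom \<Phi>)))"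
  shows "(\<lambda>x. rbregman \<Phi> (q x) x) \<in> borel_measurable (restrict_space borel (interior (edom \<Phi>)))"
proof -
  note [measurable] = q measurable_grad[OF L]
  have [measurable]: "\<Phi> \<in> borel_measurable borel"
    using L by (intro closed_fun_borel_measurable) (simp add: legendre_def)
  have [measurable]: "(\<lambda>x. x) \<in> borel_measurable (restrict_space borel (interior (edom \<Phi>)))"
    by (rule measurable_restrict_space1) simp
  have [measurable]: "\<Phi> \<in> borel_measurable (restrict_space borel (interior (edom \<Phi>)))"
    by (rule measurable_restrict_space1) simp
  show ?thesis unfolding rbregman_def by measurable
qed

section \<open>The drift of one model-based step\<close>

text \<open>The step-size \<open>\<eta>\<close> is a single number because the algorithm is run with constant steps. The lower
  bounds \<open>m\<close> of \<open>F\<close> and \<open>rinf\<close> of \<open>r\<close> make the potential function below nonnegative; the point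
  \<open>x\<^sub>0\<close> of finite objective value makes the proximal problems have a finite optimal value.\<close>
locale proximal_step = stochastic_model_setting P \<Phi> f r fm S L \<tau> \<rho> Lbar
  for P :: "'w measure" and \<Phi> r :: "'a::euclidean_space \<Rightarrow> ereal" and f fm S L \<tau> \<rho> Lbar +
  fixes lam \<eta> m rinf :: real and x\<^sub>0 :: 'a
  assumes lam: "0 < lam" "lam < 1 / (\<tau> + \<rho>)"
    and eta: "0 < \<eta>" "\<eta> \<le> lam"
    and m: "\<And>x. ereal m \<le> objective f r x"
    and rinf: "\<And>x. ereal rinf \<le> r x"
    and x0: "x\<^sub>0 \<in> interior (edom \<Phi>) \<inter> edom r"
begin

abbreviation U :: "'a set" where "U \<equiv> interior (edom \<Phi>)"
abbreviation D :: "'a \<Rightarrow> 'a \<Rightarrow> real" where "D \<equiv> rbregman \<Phi>"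
abbreviation rr :: "'a \<Rightarrow> real" where "rr x \<equiv> real_of_ereal (r x)"
abbreviation prox :: "'a \<Rightarrow> 'a" where "prox \<equiv> bregman_prox \<Phi> lam (objective f r)"

definition env :: "'a \<Rightarrow> real" where
  "env x = f (prox x) + rr (prox x) + (1 / lam) * D (prox x) x"

text \<open>\<open>\<gamma> = \<eta> / (1 - \<eta> \<rho>)\<close> is the weight with which the index of the returned point is sampled,
  written so that it visibly inverts the coefficient \<open>1/\<eta> - \<rho>\<close> of the three-point inequality.\<close>
definition \<gamma> :: real where "\<gamma> = 1 / (1 / \<eta> - \<rho>)"

text \<open>The envelope alone need not decrease on average: the pointwise inequality for a step compares
  \<open>f\<close> at \<open>x\<close> with \<open>r\<close> at the next iterate, so the regularizer enters with a time shift. Adding \<open>\<gamma>/\<lambda>\<close> times \<open>r\<close> turns that shift into a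
  telescoping difference, and the subtracted constants make both summands nonnegative.\<close>
definition potential :: "'a \<Rightarrow> real" where
  "potential x = (env x - m) + \<gamma> / lam * (rr x - rinf)"

text \<open>With values in the extended nonnegative reals the drift inequality holds at all points of \<open>U\<close>, and
  none of the integrals along the run needs an integrability argument.\<close>
definition lyapunov :: "'a \<Rightarrow> ennreal" where
  "lyapunov x = (if x \<in> edom r then ennreal (potential x) else \<infinity>)"

text \<open>The amount of potential lost in one step per unit of divergence between the current point and its
  proximal point.\<close>
definition \<kappa> :: real where "\<kappa> = \<gamma> / lam * (1 / lam - \<tau> - \<rho>)"

lemma U_edom: "x \<in> U \<Longrightarrow> x \<in> edom \<Phi>" using interior_subset by auto

lemma bregman_U: "y \<in> U \<Longrightarrow> x \<in> U \<Longrightarrow> bregman \<Phi> y x = ereal (D y x)"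
  by (intro bregman_eq legendre U_edom)

lemma D_nonneg: "y \<in> U \<Longrightarrow> x \<in> U \<Longrightarrow> 0 \<le> D y x"
  by (intro rbregman_nonneg legendre U_edom)

lemma r_real: "x \<in> edom r \<Longrightarrow> r x = ereal (rr x)"
  using r_not_MInf[of x] by (cases "r x") (auto simp: edom_def)

lemma rinf_le: "x \<in> edom r \<Longrightarrow> rinf \<le> rr x"
  using rinf[of x] r_real[of x] by (metis ereal_less_eq(3))

lemma m_le: "x \<in> edom r \<Longrightarrow> m \<le> f x + rr x"
  using m[of x] r_real[of x] unfolding objective_def by (metis ereal_less_eq(3) plus_ereal.simps(1))

lemma lam_inv: "\<tau> + \<rho> < 1 / lam"
  using lam constants_pos by (simp add: field_simps)

lemma eta_inv: "1 / lam \<le> 1 / \<eta>"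
  using lam eta by (simp add: frac_le)

lemma gamma_pos: "0 < \<gamma>" and gamma_inv: "\<gamma> * (1 / \<eta> - \<rho>) = 1"
proof -
  have "0 < 1 / \<eta> - \<rho>" using lam_inv eta_inv constants_pos by linarith
  then show "0 < \<gamma>" "\<gamma> * (1 / \<eta> - \<rho>) = 1" by (auto simp: \<gamma>_def)
qed

lemma kappa_pos: "0 < \<kappa>"
  unfolding \<kappa>_def using gamma_pos lam lam_inv by simp

text \<open>A minimizer over the whole space exists, is unique and lies in \<open>U\<close>, hence it is the point that the
  choice operator in \<open>bregman_prox\<close> picks. Comparison with \<open>x\<^sub>0\<close> shows that \<open>r\<close> is finite there.\<close>
lemma
  assumes x: "x \<in> U"
  shows prox_U: "prox x \<in> U" and prox_edom: "prox x \<in> edom r"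
    and prox_le: "\<And>y. y \<in> U \<Longrightarrow> y \<in> edom r \<Longrightarrow> env x \<le> f y + rr y + (1 / lam) * D y x"
    and bregman_env_eq: "bregman_env \<Phi> lam (objective f r) x = ereal (env x)"
proof -
  define h where "h = (\<lambda>z. objective f r z + ereal (1 / lam) * bregman \<Phi> z x)"
  obtain y where y: "y \<in> U" "unique_minimizer_on UNIV h y"
    using prox_unique[OF lam x] unfolding h_def by blast
  have "is_arg_min h (\<lambda>_. True) (prox x)"
    unfolding bregman_prox_def arg_min_def h_def[symmetric]
    by (rule someI[of _ y]) (use y in \<open>simp add: unique_minimizer_on_def\<close>)
  moreover then have "prox x = y"
    using y(2) unfolding unique_minimizer_on_def by simp
  ultimately have pU: "prox x \<in> U" and pmin: "\<And>y. h (prox x) \<le> h y"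
    using y by (auto simp: is_arg_min_linorder)
  then show "prox x \<in> U" by simp
  have hU: "h y = ereal (f y + rr y + (1 / lam) * D y x)" if "y \<in> U" "y \<in> edom r" for y
    unfolding h_def bregman_U[OF that(1) x] objective_def by (subst r_real[OF that(2)]) simp
  have "h (prox x) < \<infinity>"
    using pmin[of x\<^sub>0] hU[of x\<^sub>0] x0 by auto
  then have pr: "prox x \<in> edom r"
    unfolding h_def bregman_U[OF pU x] objective_def edom_def
    using r_not_MInf[of "prox x"] by (cases "r (prox x)") auto
  then show "prox x \<in> edom r" .
  have env: "h (prox x) = ereal (env x)"
    unfolding hU[OF pU pr] env_def ..
  show "env x \<le> f y + rr y + (1 / lam) * D y x" if "y \<in> U" "y \<in> edom r" for y
    using pmin[of y] unfolding hU[OF that] env by simp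
  show "bregman_env \<Phi> lam (objective f r) x = ereal (env x)"
    unfolding bregman_env_def env[symmetric] h_def[symmetric]
    by (intro antisym INF_lower INF_greatest pmin) simp
qed

lemma env_le: "x \<in> U \<Longrightarrow> x \<in> edom r \<Longrightarrow> env x \<le> f x + rr x"
  using prox_le[of x x] by simp

lemma m_le_env: "x \<in> U \<Longrightarrow> m \<le> env x"
  unfolding env_def using m_le[OF prox_edom, of x] D_nonneg[OF prox_U, of x x] lam by (simp add: add_increasing2)

lemma potential_nonneg: "x \<in> U \<Longrightarrow> x \<in> edom r \<Longrightarrow> 0 \<le> potential x"
  unfolding potential_def using m_le_env[of x] rinf_le[of x] gamma_pos lam by simp

lemma lyapunov_measurable [measurable]: "lyapunov \<in> borel_measurable (restrict_space borel U)"
  and D_prox_measurable [measurable]: "(\<lambda>x. D (prox x) x) \<in> borel_measurable (restrict_space borel U)"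
proof -
  have p [measurable]: "prox \<in> borel_measurable (restrict_space borel U)"
    by (rule prox_measurable[OF lam])
  show [measurable]: "(\<lambda>x. D (prox x) x) \<in> borel_measurable (restrict_space borel U)"
    by (rule measurable_rbregman[OF legendre p])
  have [measurable]: "r \<in> borel_measurable borel"
    by (rule closed_fun_borel_measurable[OF r_closed])
  have [measurable]: "r \<in> borel_measurable (restrict_space borel U)"
    by (rule measurable_restrict_space1) simp
  have [measurable]: "f \<in> borel_measurable borel"
    using locally_lipschitz_continuous[OF f_lipschitz] by (rule borel_measurable_continuous_onI)
  have lyapunov_eq: "lyapunov = (\<lambda>x. if r x < \<infinity> then ennreal (potential x) else \<infinity>)"
    by (simp add: lyapunov_def edom_def fun_eq_iff)
  show "lyapunov \<in> borel_measurable (restrict_space borel U)"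
    unfolding lyapunov_eq potential_def env_def by measurable
qed

text \<open>The three-point inequality for the sampled model, with the proximal point of \<open>x\<close> as competitor.
  The one-sided Lipschitz bound replaces the model value at the new iterate, which has no computable mean, by
  the one at \<open>x\<close>; the price
  \<open>L(\<xi>) sqrt D - D/\<eta>\<close>, with \<open>D\<close> the divergence from \<open>x\<close> to the new iterate, is at most
  \<open>\<eta> L(\<xi>)\<^sup>2 / 4\<close> by completing the square.\<close>
lemma step_pointwise:
  assumes x: "x \<in> U" "x \<in> edom r"
  shows "AE \<xi> in P. S \<eta> x \<xi> \<in> U \<and> S \<eta> x \<xi> \<in> edom r \<and>
    (1 / \<eta> - \<rho>) * D (prox x) (S \<eta> x \<xi>) + rr (S \<eta> x \<xi>)
      \<le> (fm x (prox x) \<xi> - fm x x \<xi>) + rr (prox x) + (1 / \<eta>) * D (prox x) x + \<eta> * (L \<xi>)\<^sup>2 / 4"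
proof -
  have eta': "\<eta> < 1 / (\<tau> + \<rho>)" using eta lam by simp
  have "x \<in> U \<inter> edom r" using x by simp
  from model_argmin_unique[OF eta(1) eta' x(1)] model_weakly_convex[OF this] AE_space
  show ?thesis
  proof eventually_elim
    fix \<xi> assume min: "unique_minimizer_on U (\<lambda>y. ereal (fm x y \<xi>) + r y + ereal (1 / \<eta>) * bregman \<Phi> y x) (S \<eta> x \<xi>)"
      and cvx: "rel_weakly_convex_on U \<rho> \<Phi> (\<lambda>y. ereal (fm x y \<xi>) + r y)" and xi: "\<xi> \<in> space P"
    define z where "z = S \<eta> x \<xi>"
    have min': "is_arg_min (\<lambda>y. ereal (fm x y \<xi>) + r y + ereal (1 / \<eta>) * bregman \<Phi> y x) (\<lambda>y. y \<in> U) z"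
      using min by (simp add: unique_minimizer_on_def z_def)
    then have zU: "z \<in> U" by (simp add: is_arg_min_def)
    have "ereal (fm x z \<xi>) + r z + ereal (1 / \<eta>) * bregman \<Phi> z x
        \<le> ereal (fm x x \<xi>) + r x + ereal (1 / \<eta>) * bregman \<Phi> x x"
      using min' x by (auto simp: is_arg_min_linorder)
    also have "\<dots> < \<infinity>"
      unfolding bregman_U[OF x(1) x(1)] by (subst r_real[OF x(2)]) simp
    finally have zr: "z \<in> edom r"
      unfolding bregman_U[OF zU x(1)] edom_def by (cases "r z") auto
    have fin: "ereal (fm x y \<xi>) + r y = ereal (fm x y \<xi> + rr y)" if "y \<in> edom r" for y
      by (subst r_real[OF that]) simp
    have "real_of_ereal (ereal (fm x z \<xi>) + r z) + 1 / \<eta> * D z x + (1 / \<eta> - \<rho>) * D (prox x) z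
        \<le> real_of_ereal (ereal (fm x (prox x) \<xi>) + r (prox x)) + 1 / \<eta> * D (prox x) x"
    proof (rule bregman_three_point[OF legendre x(1) min' prox_U[OF x(1)] _ _ _ cvx])
      show "ereal (fm x w \<xi>) + r w \<noteq> - \<infinity>" for w
        using r_not_MInf[of w] by (cases "r w") auto
    qed (simp_all add: fin zr prox_edom x)
    then have 1: "fm x z \<xi> + rr z + 1 / \<eta> * D z x + (1 / \<eta> - \<rho>) * D (prox x) z
        \<le> fm x (prox x) \<xi> + rr (prox x) + 1 / \<eta> * D (prox x) x"
      by (simp add: fin zr prox_edom x)
    have 2: "fm x x \<xi> - fm x z \<xi> \<le> L \<xi> * sqrt (D z x)"
      using model_lipschitz[OF _ _ xi, of x z] x zU zr by (simp add: bregman_U)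
    have "0 \<le> (\<eta> * L \<xi> / 2 - sqrt (D z x))\<^sup>2 / \<eta>" using eta by simp
    also have "\<dots> = \<eta> * (L \<xi>)\<^sup>2 / 4 - L \<xi> * sqrt (D z x) + 1 / \<eta> * D z x"
      using eta D_nonneg[OF zU x(1)] by (simp add: power2_diff field_simps power2_eq_square)
    finally show "S \<eta> x \<xi> \<in> U \<and> S \<eta> x \<xi> \<in> edom r \<and>
      (1 / \<eta> - \<rho>) * D (prox x) (S \<eta> x \<xi>) + rr (S \<eta> x \<xi>)
      \<le> (fm x (prox x) \<xi> - fm x x \<xi>) + rr (prox x) + (1 / \<eta>) * D (prox x) x + \<eta> * (L \<xi>)\<^sup>2 / 4"
      using zU zr 1 2 unfolding z_def[symmetric] by simp
  qed
qed

text \<open>The proximal point \<open>p\<close> of \<open>x\<close> is a competitor in the envelope at the new iterate \<open>z\<close>, so the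
  envelope at \<open>z\<close> is at most \<open>F(p) + D(p, z)/\<lambda>\<close>, and \<open>D(p, z)\<close> is controlled by the pointwise
  inequality. Taking expectations, unbiasedness and the one-sided accuracy of the model turn model values into
  \<open>f(x)\<close> and \<open>f(p) + \<tau> D(p, x)\<close>. Finally \<open>F(p) + D(p, x)/\<lambda> \<le> F(x)\<close>, by definition of \<open>p\<close>,
  leaves exactly the negative term \<open>-\<kappa> D(p, x)\<close>.\<close>
lemma step_drift:
  assumes x: "x \<in> U"
  shows "(\<integral>\<^sup>+\<xi>. lyapunov (S \<eta> x \<xi>) \<partial>P) + ennreal (\<kappa> * D (prox x) x)
    \<le> lyapunov x + ennreal (\<gamma> / lam * (\<eta> * Lbar\<^sup>2 / 4))"
proof (cases "x \<in> edom r")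
  case False
  then show ?thesis by (simp add: lyapunov_def)
next
  case True
  note x = x True
  let ?p = "prox x"
  note p = prox_U[OF x(1)] prox_edom[OF x(1)]
  have gl: "0 < \<gamma> / lam" using gamma_pos lam by simp
  define R where "R = (\<lambda>\<xi>. (fm x ?p \<xi> - fm x x \<xi>) + rr ?p + (1 / \<eta>) * D ?p x + \<eta> * (L \<xi>)\<^sup>2 / 4)"
  \<comment> \<open>\<open>W\<close> dominates the potential at the new iterate and, unlike it, has a computable integral.\<close>
  define W where "W = (\<lambda>\<xi>. f ?p + rr ?p - m + \<gamma> / lam * (R \<xi> - rinf))"
  have pot: "AE \<xi> in P. lyapunov (S \<eta> x \<xi>) \<le> ennreal (W \<xi>) \<and> 0 \<le> W \<xi>"
    using step_pointwise[OF x]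
  proof eventually_elim
    fix \<xi> assume *: "S \<eta> x \<xi> \<in> U \<and> S \<eta> x \<xi> \<in> edom r \<and>
      (1 / \<eta> - \<rho>) * D ?p (S \<eta> x \<xi>) + rr (S \<eta> x \<xi>)
      \<le> (fm x ?p \<xi> - fm x x \<xi>) + rr ?p + (1 / \<eta>) * D ?p x + \<eta> * (L \<xi>)\<^sup>2 / 4"
    define z where "z = S \<eta> x \<xi>"
    have z: "z \<in> U" "z \<in> edom r" "(1 / \<eta> - \<rho>) * D ?p z + rr z \<le> R \<xi>"
      using * by (auto simp: z_def R_def)
    have "\<gamma> / lam * ((1 / \<eta> - \<rho>) * D ?p z) = (\<gamma> * (1 / \<eta> - \<rho>)) * (1 / lam * D ?p z)"
      by (simp only: divide_inverse mult_ac mult_1_left)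
    then have "\<gamma> / lam * ((1 / \<eta> - \<rho>) * D ?p z) = 1 / lam * D ?p z"
      by (simp only: gamma_inv mult_1_left)
    moreover have "\<gamma> / lam * ((1 / \<eta> - \<rho>) * D ?p z + rr z) \<le> \<gamma> / lam * R \<xi>"
      using z(3) gl by (intro mult_left_mono) auto
    ultimately have "1 / lam * D ?p z + \<gamma> / lam * rr z \<le> \<gamma> / lam * R \<xi>"
      by (simp only: distrib_left)
    then have "potential z \<le> W \<xi>"
      using prox_le[OF z(1) p] unfolding potential_def W_def by (simp only: right_diff_distrib)
    then show "lyapunov (S \<eta> x \<xi>) \<le> ennreal (W \<xi>) \<and> 0 \<le> W \<xi>"
      using potential_nonneg[OF z(1,2)] z(2) unfolding lyapunov_def z_def[symmetric]
      by (auto intro: ennreal_leI)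
  qed
  have i1: "integrable P (fm x x)" "(\<integral>\<xi>. fm x x \<xi> \<partial>P) = f x"
    using model_unbiased x by auto
  have i2: "integrable P (\<lambda>\<xi>. fm x ?p \<xi> - f ?p)" "(\<integral>\<xi>. (fm x ?p \<xi> - f ?p) \<partial>P) \<le> \<tau> * D ?p x"
    using model_one_sided[of x ?p] x p by (auto simp: bregman_U)
  have W: "W = (\<lambda>\<xi>. \<gamma> / lam * (fm x ?p \<xi> - f ?p) - \<gamma> / lam * fm x x \<xi> + \<gamma> / lam * \<eta> / 4 * (L \<xi>)\<^sup>2
      + (f ?p + rr ?p - m + \<gamma> / lam * (f ?p + rr ?p + (1 / \<eta>) * D ?p x - rinf)))"
    by (auto simp: W_def R_def fun_eq_iff algebra_simps)
  have iW: "integrable P W"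
    unfolding W using i1 i2 L_square_integrable by auto
  have IW: "(\<integral>\<xi>. W \<xi> \<partial>P) = \<gamma> / lam * (\<integral>\<xi>. (fm x ?p \<xi> - f ?p) \<partial>P) - \<gamma> / lam * f x
      + \<gamma> / lam * \<eta> / 4 * (\<integral>\<xi>. (L \<xi>)\<^sup>2 \<partial>P)
      + (f ?p + rr ?p - m + \<gamma> / lam * (f ?p + rr ?p + (1 / \<eta>) * D ?p x - rinf))"
    unfolding W using i1 i2(1) L_square_integrable by (simp add: prob_space)
  have Lsq: "(\<integral>\<xi>. (L \<xi>)\<^sup>2 \<partial>P) \<le> Lbar\<^sup>2"
    using L_bound by (rule sqrt_le_D)
  have "(\<integral>\<xi>. W \<xi> \<partial>P) \<le> \<gamma> / lam * (\<tau> * D ?p x) - \<gamma> / lam * f x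
      + \<gamma> / lam * \<eta> / 4 * Lbar\<^sup>2
      + (f ?p + rr ?p - m + \<gamma> / lam * (f ?p + rr ?p + (1 / \<eta>) * D ?p x - rinf))"
    unfolding IW using i2(2) Lsq gl gamma_pos lam eta by (intro add_mono diff_mono mult_left_mono) auto
  moreover have "\<gamma> / lam * (f ?p + rr ?p + 1 / lam * D ?p x) \<le> \<gamma> / lam * (f x + rr x)"
    using env_le[OF x] gl unfolding env_def by (intro mult_left_mono) auto
  moreover have "\<gamma> / lam * ((1 / \<eta> - \<rho>) * D ?p x) = (\<gamma> * (1 / \<eta> - \<rho>)) * (1 / lam * D ?p x)"
    by (simp only: divide_inverse mult_ac mult_1_left)
  then have "\<gamma> / lam * ((1 / \<eta> - \<rho>) * D ?p x) = 1 / lam * D ?p x"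
    by (simp only: gamma_inv mult_1_left)
  ultimately have main: "(\<integral>\<xi>. W \<xi> \<partial>P) + \<kappa> * D ?p x \<le> potential x + \<gamma> / lam * (\<eta> * Lbar\<^sup>2 / 4)"
    unfolding potential_def env_def \<kappa>_def
    by (simp add: algebra_simps add_divide_distrib diff_divide_distrib)
  have W0: "0 \<le> (\<integral>\<xi>. W \<xi> \<partial>P)"
    using pot by (intro integral_nonneg_AE) auto
  have D0: "0 \<le> \<kappa> * D ?p x" using kappa_pos D_nonneg[OF p(1) x(1)] by simp
  have "(\<integral>\<^sup>+\<xi>. lyapunov (S \<eta> x \<xi>) \<partial>P) \<le> (\<integral>\<^sup>+\<xi>. ennreal (W \<xi>) \<partial>P)"
    using pot by (intro nn_integral_mono_AE) auto
  also have "\<dots> = ennreal (\<integral>\<xi>. W \<xi> \<partial>P)"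
    using pot by (intro nn_integral_eq_integral iW) auto
  finally have "(\<integral>\<^sup>+\<xi>. lyapunov (S \<eta> x \<xi>) \<partial>P) + ennreal (\<kappa> * D ?p x)
      \<le> ennreal (\<integral>\<xi>. W \<xi> \<partial>P) + ennreal (\<kappa> * D ?p x)"
    by (rule add_right_mono)
  also have "\<dots> = ennreal ((\<integral>\<xi>. W \<xi> \<partial>P) + \<kappa> * D ?p x)"
    using W0 D0 by simp
  also have "\<dots> \<le> ennreal (potential x + \<gamma> / lam * (\<eta> * Lbar\<^sup>2 / 4))"
    using main by (rule ennreal_leI)
  also have "\<dots> = lyapunov x + ennreal (\<gamma> / lam * (\<eta> * Lbar\<^sup>2 / 4))"
    using potential_nonneg[OF x] gamma_pos lam eta x(2) by (simp add: lyapunov_def)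
  finally show ?thesis .
qed

end

section \<open>The drift along a run\<close>

lemma model_iterate_cong:
  "(\<And>i. i < n \<Longrightarrow> w i = w' i) \<Longrightarrow> model_iterate S s x w n = model_iterate S s x w' n"
  by (induction n) auto

context proximal_step
begin

lemma iterate_measurable:
  assumes "{..<n} \<subseteq> I" "\<And>t. t < n \<Longrightarrow> s t = \<eta>"
  shows "(\<lambda>w. model_iterate S s x\<^sub>0 w n) \<in> PiM I (\<lambda>_. P) \<rightarrow>\<^sub>M restrict_space borel U"
  using assms
proof (induction n)
  case 0
  have "x\<^sub>0 \<in> space (restrict_space borel U)" using x0 by (simp add: space_restrict_space)
  then show ?case by simp
next
  case (Suc n)
  have eta': "\<eta> < 1 / (\<tau> + \<rho>)" using eta lam by simp
  have "(\<lambda>w. model_iterate S s x\<^sub>0 w n) \<in> PiM I (\<lambda>_. P) \<rightarrow>\<^sub>M restrict_space borel U"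
    using Suc by (intro Suc.IH) auto
  moreover have "(\<lambda>w. w n) \<in> PiM I (\<lambda>_. P) \<rightarrow>\<^sub>M P"
    using Suc.prems(1) by (intro measurable_component_singleton) auto
  ultimately have "(\<lambda>w. (model_iterate S s x\<^sub>0 w n, w n)) \<in> PiM I (\<lambda>_. P) \<rightarrow>\<^sub>M restrict_space borel U \<Otimes>\<^sub>M P"
    by (rule measurable_Pair)
  from measurable_compose[OF this model_argmin_measurable[OF eta(1) eta']]
  show ?case using Suc.prems(2)[of n] by simp
qed

lemma iterate_in_U:
  assumes "{..<n} \<subseteq> I" "\<And>t. t < n \<Longrightarrow> s t = \<eta>" "w \<in> space (PiM I (\<lambda>_. P))"
  shows "model_iterate S s x\<^sub>0 w n \<in> U"
  using measurable_space[OF iterate_measurable[OF assms(1,2)] assms(3)]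
  by (simp add: space_restrict_space)

text \<open>On the product space, the iterate at time \<open>t\<close> does not depend on coordinate \<open>t\<close>. Integrating that
  coordinate out first, with all others fixed, is the conditional expectation given the past, and the one-step
  drift applies to the inner integral.\<close>
lemma iterate_drift:
  assumes s: "\<And>t. t \<le> T \<Longrightarrow> s t = \<eta>" and t: "t \<le> T"
  defines "Q \<equiv> PiM {..T} (\<lambda>_. P)" and "X \<equiv> model_iterate S s x\<^sub>0"
  shows "(\<integral>\<^sup>+w. lyapunov (X w (Suc t)) \<partial>Q) + (\<integral>\<^sup>+w. ennreal (\<kappa> * D (prox (X w t)) (X w t)) \<partial>Q)
    \<le> (\<integral>\<^sup>+w. lyapunov (X w t) \<partial>Q) + ennreal (\<gamma> / lam * (\<eta> * Lbar\<^sup>2 / 4))"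
proof -
  interpret PP: product_sigma_finite "\<lambda>_::nat. P"
    by (simp add: product_sigma_finite_def sigma_finite_measure_axioms)
  define J where "J = {..T} - {t}"
  interpret QJ: prob_space "PiM J (\<lambda>_. P)"
    by (intro prob_space_PiM prob_space_axioms)
  have J: "finite J" "t \<notin> J" "insert t J = {..T}" "{..<t} \<subseteq> J" using t by (auto simp: J_def)
  have eta': "\<eta> < 1 / (\<tau> + \<rho>)" using eta lam by simp
  have Xt [measurable]: "(\<lambda>w. X w t) \<in> PiM J (\<lambda>_. P) \<rightarrow>\<^sub>M restrict_space borel U"
    unfolding X_def using J t by (intro iterate_measurable s) auto
  have XT: "(\<lambda>w. X w k) \<in> Q \<rightarrow>\<^sub>M restrict_space borel U" if "k \<le> Suc t" for k
    unfolding X_def Q_def using t that by (intro iterate_measurable s) auto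
  have Xupd: "X (w(t := y)) t = X w t" for w y
    unfolding X_def by (rule model_iterate_cong) simp
  have split: "(\<integral>\<^sup>+w. h w \<partial>Q) = (\<integral>\<^sup>+w. \<integral>\<^sup>+y. h (w(t := y)) \<partial>P \<partial>PiM J (\<lambda>_. P))"
    if "h \<in> borel_measurable Q" for h
    using PP.product_nn_integral_insert[OF J(1,2), of h] that unfolding Q_def J(3) by simp
  have now: "(\<integral>\<^sup>+w. g (X w t) \<partial>Q) = (\<integral>\<^sup>+w. g (X w t) \<partial>PiM J (\<lambda>_. P))"
    if "g \<in> borel_measurable (restrict_space borel U)" for g :: "'a \<Rightarrow> ennreal"
    using split[OF measurable_compose[OF XT[of t] that]] by (simp add: Xupd emeasure_space_1)
  have "(\<integral>\<^sup>+w. lyapunov (X w (Suc t)) \<partial>Q) = (\<integral>\<^sup>+w. \<integral>\<^sup>+y. lyapunov (X (w(t := y)) (Suc t)) \<partial>P \<partial>PiM J (\<lambda>_. P))"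
    by (rule split[OF measurable_compose[OF XT[of "Suc t"] lyapunov_measurable]]) simp
  also have "\<dots> = (\<integral>\<^sup>+w. \<integral>\<^sup>+y. lyapunov (S \<eta> (X w t) y) \<partial>P \<partial>PiM J (\<lambda>_. P))"
  proof -
    have "X (w(t := y)) (Suc t) = S \<eta> (X w t) y" for w y
      using Xupd[of w y] s[OF t] by (simp add: X_def)
    then show ?thesis by simp
  qed
  finally have next': "(\<integral>\<^sup>+w. lyapunov (X w (Suc t)) \<partial>Q) = (\<integral>\<^sup>+w. \<integral>\<^sup>+y. lyapunov (S \<eta> (X w t) y) \<partial>P \<partial>PiM J (\<lambda>_. P))" .
  have "(\<lambda>(w, y). (X w t, y)) \<in> PiM J (\<lambda>_. P) \<Otimes>\<^sub>M P \<rightarrow>\<^sub>M restrict_space borel U \<Otimes>\<^sub>M P"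
    by measurable
  from measurable_compose[OF measurable_compose[OF this model_argmin_measurable[OF eta(1) eta']] lyapunov_measurable]
  have "(\<lambda>(w, y). lyapunov (S \<eta> (X w t) y)) \<in> borel_measurable (PiM J (\<lambda>_. P) \<Otimes>\<^sub>M P)"
    by (simp add: split_beta')
  then have inner [measurable]: "(\<lambda>w. \<integral>\<^sup>+y. lyapunov (S \<eta> (X w t) y) \<partial>P) \<in> borel_measurable (PiM J (\<lambda>_. P))"
    by (rule borel_measurable_nn_integral)
  have G: "(\<lambda>x. ennreal (\<kappa> * D (prox x) x)) \<in> borel_measurable (restrict_space borel U)"
    by measurable
  note [measurable] = measurable_compose[OF Xt lyapunov_measurable] measurable_compose[OF Xt G]
  have "(\<integral>\<^sup>+w. lyapunov (X w (Suc t)) \<partial>Q) + (\<integral>\<^sup>+w. ennreal (\<kappa> * D (prox (X w t)) (X w t)) \<partial>Q)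
    = (\<integral>\<^sup>+w. (\<integral>\<^sup>+y. lyapunov (S \<eta> (X w t) y) \<partial>P) + ennreal (\<kappa> * D (prox (X w t)) (X w t)) \<partial>PiM J (\<lambda>_. P))"
    unfolding next' now[OF G] by (rule nn_integral_add[symmetric]) measurable
  also have "\<dots> \<le> (\<integral>\<^sup>+w. lyapunov (X w t) + ennreal (\<gamma> / lam * (\<eta> * Lbar\<^sup>2 / 4)) \<partial>PiM J (\<lambda>_. P))"
    using iterate_in_U[OF J(4), of s] s t unfolding X_def
    by (intro nn_integral_mono step_drift) simp
  also have "\<dots> = (\<integral>\<^sup>+w. lyapunov (X w t) \<partial>PiM J (\<lambda>_. P)) + ennreal (\<gamma> / lam * (\<eta> * Lbar\<^sup>2 / 4))"
    by (subst nn_integral_add, measurable) (simp add: QJ.emeasure_space_1)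
  also have "\<dots> = (\<integral>\<^sup>+w. lyapunov (X w t) \<partial>Q) + ennreal (\<gamma> / lam * (\<eta> * Lbar\<^sup>2 / 4))"
    by (simp only: now[OF lyapunov_measurable])
  finally show ?thesis .
qed

text \<open>Telescoping the drift; the potential left over at the final time is nonnegative and is dropped.\<close>
lemma sum_divergence_le:
  assumes s: "\<And>t. t \<le> T \<Longrightarrow> s t = \<eta>"
  defines "Q \<equiv> PiM {..T} (\<lambda>_. P)" and "X \<equiv> model_iterate S s x\<^sub>0"
  shows "ennreal \<kappa> * (\<Sum>t\<le>T. \<integral>\<^sup>+w. ennreal (D (prox (X w t)) (X w t)) \<partial>Q)
    \<le> ennreal (potential x\<^sub>0 + real (Suc T) * (\<gamma> / lam * (\<eta> * Lbar\<^sup>2 / 4)))"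
proof -
  interpret Q: prob_space Q
    unfolding Q_def by (intro prob_space_PiM prob_space_axioms)
  define c where "c = \<gamma> / lam * (\<eta> * Lbar\<^sup>2 / 4)"
  define e where "e t = (\<integral>\<^sup>+w. ennreal (\<kappa> * D (prox (X w t)) (X w t)) \<partial>Q)" for t
  have c0: "0 \<le> c" using gamma_pos lam eta by (simp add: c_def)
  have "(\<integral>\<^sup>+w. lyapunov (X w n) \<partial>Q) + (\<Sum>t<n. e t) \<le> lyapunov x\<^sub>0 + ennreal (real n * c)" if "n \<le> Suc T" for n
    using that
  proof (induction n)
    case 0
    then show ?case by (simp add: X_def Q.emeasure_space_1)
  next
    case (Suc n)
    have "(\<integral>\<^sup>+w. lyapunov (X w (Suc n)) \<partial>Q) + (\<Sum>t<Suc n. e t)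
        = ((\<integral>\<^sup>+w. lyapunov (X w (Suc n)) \<partial>Q) + e n) + (\<Sum>t<n. e t)"
      by (simp add: ac_simps)
    also have "\<dots> \<le> ((\<integral>\<^sup>+w. lyapunov (X w n) \<partial>Q) + ennreal c) + (\<Sum>t<n. e t)"
      using iterate_drift[of T s n, OF s] Suc.prems
      unfolding e_def X_def Q_def c_def by (intro add_right_mono) simp
    also have "\<dots> = ((\<integral>\<^sup>+w. lyapunov (X w n) \<partial>Q) + (\<Sum>t<n. e t)) + ennreal c"
      by (simp add: ac_simps)
    also have "\<dots> \<le> (lyapunov x\<^sub>0 + ennreal (real n * c)) + ennreal c"
      using Suc by (intro add_right_mono) simp
    also have "\<dots> = lyapunov x\<^sub>0 + ennreal (real (Suc n) * c)"
      using c0 by (simp add: add.assoc distrib_right add.commute flip: ennreal_plus)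
    finally show ?case .
  qed
  from this[of "Suc T"] have "(\<Sum>t<Suc T. e t) \<le> lyapunov x\<^sub>0 + ennreal (real (Suc T) * c)"
    by (meson add_increasing dual_order.trans order_refl zero_le)
  moreover have "lyapunov x\<^sub>0 + ennreal (real (Suc T) * c) = ennreal (potential x\<^sub>0 + real (Suc T) * c)"
    using x0 potential_nonneg[of x\<^sub>0] c0 by (simp add: lyapunov_def del: of_nat_Suc)
  moreover have "e t = ennreal \<kappa> * (\<integral>\<^sup>+w. ennreal (D (prox (X w t)) (X w t)) \<partial>Q)" if "t \<le> T" for t
  proof -
    have "(\<lambda>w. X w t) \<in> Q \<rightarrow>\<^sub>M restrict_space borel U"
      unfolding X_def Q_def using that by (intro iterate_measurable s) auto
    note [measurable] = measurable_compose[OF this D_prox_measurable]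
    show ?thesis
      unfolding e_def using kappa_pos
      by (subst nn_integral_cmult[symmetric], measurable) (simp add: ennreal_mult')
  qed
  ultimately show ?thesis
    unfolding c_def[symmetric] sum_distrib_left lessThan_Suc_atMost by simp
qed

end

section \<open>Sampling the returned index\<close>

lemma tstar_le:
  assumes rnd: "algorithm_randomness M P T \<rho> \<eta> \<xi> tstar"
    and weights: "(\<Sum>t\<le>T. \<eta> t / (1 - \<eta> t * \<rho>)) \<noteq> 0"
  shows "AE \<omega> in M. tstar \<omega> \<le> T"
proof -
  interpret M: prob_space M using rnd by (simp add: algorithm_randomness_def)
  have [measurable]: "tstar \<in> M \<rightarrow>\<^sub>M count_space UNIV"
    using rnd by (simp add: algorithm_randomness_def)
  have "{\<omega> \<in> space M. tstar \<omega> \<le> T} = (\<Union>n\<in>{..T}. {\<omega> \<in> space M. tstar \<omega> = n})" by auto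
  also have "M.prob \<dots> = (\<Sum>n\<le>T. M.prob {\<omega> \<in> space M. tstar \<omega> = n})"
    by (intro M.finite_measure_finite_Union) (auto simp: disjoint_family_on_def)
  also have "\<dots> = (\<Sum>n\<le>T. (\<eta> n / (1 - \<eta> n * \<rho>)) / (\<Sum>t\<le>T. \<eta> t / (1 - \<eta> t * \<rho>)))"
    using rnd by (intro sum.cong) (auto simp: algorithm_randomness_def)
  also have "\<dots> = 1"
    unfolding sum_divide_distrib[symmetric] using weights by simp
  finally show ?thesis by (auto dest: M.AE_prob_1)
qed

text \<open>Because the index is independent of the whole sample vector, their joint law is a product measure, and
  Fubini allows the expectation for each fixed index to be computed before averaging over the index.\<close>
lemma nn_integral_random_index:
  fixes h :: "nat \<Rightarrow> (nat \<Rightarrow> 'w) \<Rightarrow> ennreal"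
  assumes rnd: "algorithm_randomness M P T \<rho> \<eta> \<xi> tstar"
    and weights: "(\<Sum>t\<le>T. \<eta> t / (1 - \<eta> t * \<rho>)) \<noteq> 0"
    and h: "\<And>n. n \<le> T \<Longrightarrow> h n \<in> borel_measurable (PiM {..T} (\<lambda>_. P))"
  shows "(\<integral>\<^sup>+\<omega>. h (tstar \<omega>) (\<lambda>t\<in>{..T}. \<xi> t \<omega>) \<partial>M)
    = (\<Sum>n\<le>T. ennreal ((\<eta> n / (1 - \<eta> n * \<rho>)) / (\<Sum>t\<le>T. \<eta> t / (1 - \<eta> t * \<rho>)))
               * (\<integral>\<^sup>+w. h n w \<partial>PiM {..T} (\<lambda>_. P)))"
proof -
  interpret M: prob_space M using rnd by (simp add: algorithm_randomness_def)
  let ?Q = "PiM {..T} (\<lambda>_. P)" and ?N = "count_space (UNIV :: nat set)"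
  define X where "X = (\<lambda>\<omega>. \<lambda>t\<in>{..T}. \<xi> t \<omega>)"
  define p where "p n = (\<eta> n / (1 - \<eta> n * \<rho>)) / (\<Sum>t\<le>T. \<eta> t / (1 - \<eta> t * \<rho>))" for n
  have iv: "M.indep_vars (\<lambda>_. P) \<xi> {..T}" and law: "\<And>t. t \<le> T \<Longrightarrow> distr M P (\<xi> t) = P"
    and ts [measurable]: "tstar \<in> M \<rightarrow>\<^sub>M ?N"
    and ind: "M.indep_set (sets (vimage_algebra (space M) X ?Q))
       (sets (vimage_algebra (space M) tstar ?N))"
    and prob: "\<And>t. t \<le> T \<Longrightarrow> measure M {\<omega> \<in> space M. tstar \<omega> = t} = p t"
    using rnd by (auto simp: algorithm_randomness_def X_def p_def)
  have rv: "\<And>t. t \<in> {..T} \<Longrightarrow> \<xi> t \<in> M \<rightarrow>\<^sub>M P"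
    using iv unfolding M.indep_vars_def2 by blast
  then have X [measurable]: "X \<in> M \<rightarrow>\<^sub>M ?Q"
    unfolding X_def by (intro measurable_restrict) auto
  have "distr M ?Q X = (\<Pi>\<^sub>M t\<in>{..T}. distr M P (\<xi> t))"
    using M.indep_vars_iff_distr_eq_PiM'[of "{..T}" \<xi> "\<lambda>_. P"] rv iv unfolding X_def by auto
  also have "\<dots> = ?Q" using law by (intro PiM_cong) auto
  finally have distX: "distr M ?Q X = ?Q" .
  have AE: "AE \<omega> in M. tstar \<omega> \<le> T" by (rule tstar_le[OF rnd weights])
  interpret N: prob_space "distr M ?N tstar" by (rule M.prob_space_distr) simp
  interpret Q: prob_space ?Q
    using M.prob_space_distr[OF X] unfolding distX .
  interpret QN: pair_sigma_finite ?Q "distr M ?N tstar" ..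
  have joint: "?Q \<Otimes>\<^sub>M distr M ?N tstar = distr M (?Q \<Otimes>\<^sub>M ?N) (\<lambda>\<omega>. (X \<omega>, tstar \<omega>))"
  proof (rule pair_measure_eqI)
    show "sigma_finite_measure ?Q" "sigma_finite_measure (distr M ?N tstar)" ..
    show "sets (?Q \<Otimes>\<^sub>M distr M ?N tstar) = sets (distr M (?Q \<Otimes>\<^sub>M ?N) (\<lambda>\<omega>. (X \<omega>, tstar \<omega>)))"
      unfolding sets_distr by (rule sets_pair_measure_cong) simp_all
  next
    fix A B assume A: "A \<in> sets ?Q" and B: "B \<in> sets (distr M ?N tstar)"
    have "X -` A \<inter> space M \<in> sets (vimage_algebra (space M) X ?Q)"
      "tstar -` B \<inter> space M \<in> sets (vimage_algebra (space M) tstar ?N)"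
      using A by (auto intro!: in_vimage_algebra)
    note factor = M.indep_setD[OF ind this]
    have "emeasure ?Q A = emeasure M (X -` A \<inter> space M)"
      using emeasure_distr[OF X A] unfolding distX .
    moreover have "emeasure (distr M ?N tstar) B = emeasure M (tstar -` B \<inter> space M)"
      using B by (simp add: emeasure_distr)
    moreover have "emeasure (distr M (?Q \<Otimes>\<^sub>M ?N) (\<lambda>\<omega>. (X \<omega>, tstar \<omega>))) (A \<times> B)
        = emeasure M ((\<lambda>\<omega>. (X \<omega>, tstar \<omega>)) -` (A \<times> B) \<inter> space M)"
      using A B by (intro emeasure_distr) auto
    moreover have "(\<lambda>\<omega>. (X \<omega>, tstar \<omega>)) -` (A \<times> B) \<inter> space M
        = (X -` A \<inter> space M) \<inter> (tstar -` B \<inter> space M)" by auto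
    ultimately show "emeasure ?Q A * emeasure (distr M ?N tstar) B
        = emeasure (distr M (?Q \<Otimes>\<^sub>M ?N) (\<lambda>\<omega>. (X \<omega>, tstar \<omega>))) (A \<times> B)"
      using factor by (simp add: M.emeasure_eq_measure ennreal_mult)
  qed
  \<comment> \<open>Indices beyond \<open>T\<close> have probability zero, but \<open>h\<close> need not be measurable there.\<close>
  define g where "g n = (if n \<le> T then h n else (\<lambda>_. 0))" for n
  have g: "g n \<in> borel_measurable ?Q" for n using h by (simp add: g_def)
  have gm': "(\<lambda>(w, n). g n w) \<in> borel_measurable (?Q \<Otimes>\<^sub>M ?N)"
    unfolding split_beta'
    by (rule measurable_compose_countable[OF measurable_compose[OF measurable_fst g] measurable_snd])
  have gm: "(\<lambda>(w, n). g n w) \<in> borel_measurable (?Q \<Otimes>\<^sub>M distr M ?N tstar)"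
    using gm' by (subst measurable_cong_sets[OF sets_pair_measure_cong[OF refl sets_distr] refl])
  have "(\<integral>\<^sup>+\<omega>. h (tstar \<omega>) (X \<omega>) \<partial>M) = (\<integral>\<^sup>+\<omega>. g (tstar \<omega>) (X \<omega>) \<partial>M)"
    using AE by (intro nn_integral_cong_AE) (auto simp: g_def)
  also have "\<dots> = (\<integral>\<^sup>+x. (case x of (w, n) \<Rightarrow> g n w) \<partial>distr M (?Q \<Otimes>\<^sub>M ?N) (\<lambda>\<omega>. (X \<omega>, tstar \<omega>)))"
    using gm' by (subst nn_integral_distr) auto
  also have "\<dots> = (\<integral>\<^sup>+n. \<integral>\<^sup>+w. g n w \<partial>?Q \<partial>distr M ?N tstar)"
    unfolding joint[symmetric] using QN.nn_integral_snd[OF gm] by simp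
  also have "\<dots> = (\<integral>\<^sup>+\<omega>. (\<integral>\<^sup>+w. g (tstar \<omega>) w \<partial>?Q) \<partial>M)"
    by (subst nn_integral_distr) auto
  also have "\<dots> = (\<integral>\<^sup>+\<omega>. (\<Sum>n\<le>T. (\<integral>\<^sup>+w. h n w \<partial>?Q) * indicator {\<omega> \<in> space M. tstar \<omega> = n} \<omega>) \<partial>M)"
  proof (rule nn_integral_cong)
    fix \<omega> assume "\<omega> \<in> space M"
    then have "(\<Sum>n\<le>T. (\<integral>\<^sup>+w. h n w \<partial>?Q) * indicator {\<omega> \<in> space M. tstar \<omega> = n} \<omega>)
        = (\<Sum>n\<le>T. if n = tstar \<omega> then \<integral>\<^sup>+w. h n w \<partial>?Q else 0)"
      by (intro sum.cong) (auto simp: indicator_def)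
    then show "(\<integral>\<^sup>+w. g (tstar \<omega>) w \<partial>?Q)
        = (\<Sum>n\<le>T. (\<integral>\<^sup>+w. h n w \<partial>?Q) * indicator {\<omega> \<in> space M. tstar \<omega> = n} \<omega>)"
      by (simp add: g_def)
  qed
  also have "\<dots> = (\<Sum>n\<le>T. (\<integral>\<^sup>+w. h n w \<partial>?Q) * emeasure M {\<omega> \<in> space M. tstar \<omega> = n})"
    by (subst nn_integral_sum) (auto intro!: sum.cong nn_integral_cmult_indicator)
  also have "\<dots> = (\<Sum>n\<le>T. ennreal (p n) * (\<integral>\<^sup>+w. h n w \<partial>?Q))"
    by (intro sum.cong) (auto simp: M.emeasure_eq_measure prob mult.commute)
  finally show ?thesis by (simp add: X_def p_def)
qed

section \<open>The convergence rate\<close>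

text \<open>With \<open>K = 1/\<lambda> - \<rho> + sqrt N / \<alpha> = 1/\<gamma>\<close> the rate factor on the right is \<open>K / N\<close>. The
  coefficient of \<open>A\<close> matches exactly. The other two terms need a factor \<open>K / N\<close> to be inserted:
  \<open>B\<close> uses that \<open>K\<close> is smallest for \<open>N = 1\<close>, and \<open>Lb\<close> uses
  \<open>\<eta> \<le> \<alpha> / sqrt N \<le> \<alpha>\<^sup>2 K / N\<close>.\<close>
lemma rate_arithmetic:
  fixes lam \<alpha> \<tau> \<rho> A B Lb :: real and T :: nat
  assumes pos: "0 < lam" "0 < \<alpha>" "0 < \<tau>" "0 < \<rho>" and q: "lam * (\<tau> + \<rho>) < 1"
    and B: "0 \<le> B"
  defines "N \<equiv> real T + 1"
  defines "\<eta> \<equiv> 1 / (1 / lam + sqrt N / \<alpha>)"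
  defines "\<gamma> \<equiv> 1 / (1 / \<eta> - \<rho>)"
  shows "(A + \<gamma> / lam * B + N * (\<gamma> / lam * (\<eta> * Lb\<^sup>2 / 4))) / (N * (\<gamma> / lam * (1 / lam - \<tau> - \<rho>)))
    \<le> (lam\<^sup>2 * A + lam * Lb\<^sup>2 * \<alpha>\<^sup>2 / 4 + lam * B / (1 / lam - \<rho> + 1 / \<alpha>)) / (1 - lam * (\<tau> + \<rho>))
       * ((1 / lam - \<rho>) / N + 1 / (\<alpha> * sqrt N))"
proof -
  define s where "s = sqrt N"
  have N: "1 \<le> N" by (simp add: N_def)
  then have s: "1 \<le> s" "s * s = N" by (auto simp: s_def)
  define K where "K = 1 / lam - \<rho> + s / \<alpha>"
  define K\<^sub>1 where "K\<^sub>1 = 1 / lam - \<rho> + 1 / \<alpha>"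
  define q where "q = 1 - lam * (\<tau> + \<rho>)"
  have q0: "0 < q" using q by (simp add: q_def)
  have lr: "\<rho> < 1 / lam"
  proof -
    have "0 < lam * \<tau>" using pos by simp
    then have "\<rho> * lam < 1" using q unfolding distrib_left mult.commute[of \<rho>] by linarith
    then show ?thesis using pos by (simp add: field_simps)
  qed
  have K1: "0 < K\<^sub>1" using lr pos by (simp add: K\<^sub>1_def add_pos_pos)
  have KK: "K\<^sub>1 \<le> K" using s pos by (simp add: K_def K\<^sub>1_def divide_right_mono)
  have eta: "0 < \<eta>" "\<eta> \<le> \<alpha> / s"
  proof -
    have sa: "0 < s / \<alpha>" using s pos by simp
    have l: "0 < 1 / lam" using pos by simp
    then show "0 < \<eta>" unfolding \<eta>_def s_def[symmetric] using sa by (simp add: add_pos_pos)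
    have "1 / (1 / lam + s / \<alpha>) \<le> 1 / (s / \<alpha>)"
      using sa l by (intro frac_le) auto
    then show "\<eta> \<le> \<alpha> / s" unfolding \<eta>_def s_def[symmetric] by simp
  qed
  have ieta: "1 / \<eta> - \<rho> = K" by (simp add: \<eta>_def K_def s_def)
  have gam: "\<gamma> = 1 / K" by (simp add: \<gamma>_def ieta)
  have inv: "1 / lam - \<tau> - \<rho> = q / lam" using pos by (simp add: q_def field_simps)
  have s0: "0 < s" using s by simp
  have sN: "s / \<alpha> / N = 1 / (\<alpha> * s)"
    unfolding s(2)[symmetric] using s0 pos by (simp add: divide_simps)
  have rate: "(1 / lam - \<rho>) / N + 1 / (\<alpha> * sqrt N) = K / N"
    unfolding s_def[symmetric] K_def add_divide_distrib[of _ "s / \<alpha>"] sN ..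
  have K0: "0 < K" using K1 KK by linarith
  have "(A + \<gamma> / lam * B + N * (\<gamma> / lam * (\<eta> * Lb\<^sup>2 / 4))) / (N * (\<gamma> / lam * (q / lam)))
      = (lam\<^sup>2 * A * (K / N) + lam * B / N + lam * Lb\<^sup>2 / 4 * \<eta>) / q"
    unfolding gam using K0 N pos q0 by (simp add: field_simps power2_eq_square)
  also have "\<dots> \<le> (lam\<^sup>2 * A * (K / N) + lam * B / K\<^sub>1 * (K / N) + lam * Lb\<^sup>2 / 4 * (\<alpha>\<^sup>2 * (K / N))) / q"
  proof -
    have "lam * B / N * 1 \<le> lam * B / N * (K / K\<^sub>1)"
      using KK K1 pos B N by (intro mult_left_mono) auto
    then have b: "lam * B / N \<le> lam * B / K\<^sub>1 * (K / N)" by (simp add: field_simps)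
    have "s / \<alpha> \<le> K" using lr by (simp add: K_def)
    then have "\<alpha>\<^sup>2 * (s / \<alpha> / N) \<le> \<alpha>\<^sup>2 * (K / N)"
      using N by (intro mult_left_mono divide_right_mono) auto
    moreover have "\<alpha>\<^sup>2 * (s / \<alpha> / N) = \<alpha> / s"
      unfolding sN using s0 pos by (simp add: divide_simps power2_eq_square)
    ultimately have "lam * Lb\<^sup>2 / 4 * \<eta> \<le> lam * Lb\<^sup>2 / 4 * (\<alpha>\<^sup>2 * (K / N))"
      using eta(2) pos by (intro mult_left_mono) auto
    with b show ?thesis using q0 by (intro divide_right_mono add_mono) auto
  qed
  also have "\<dots> = (lam\<^sup>2 * A + lam * Lb\<^sup>2 * \<alpha>\<^sup>2 / 4 + lam * B / K\<^sub>1) / q * (K / N)"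
    by (simp add: algebra_simps add_divide_distrib)
  finally show ?thesis
    unfolding inv rate K\<^sub>1_def q_def .
qed

lemma ereal_quotient_arithmetic:
  assumes "0 < d\<^sub>1" "0 < d\<^sub>2"
  shows "(ereal a * (ereal e - ereal m) + ereal b + ereal l * (ereal x - ereal y) / ereal d\<^sub>1) / ereal d\<^sub>2 * ereal c
    = ereal ((a * (e - m) + b + l * (x - y) / d\<^sub>1) / d\<^sub>2 * c)"
  using assms by simp

theorem corollary5p3:
  fixes P :: "'w measure" and M :: "'s measure"
    and \<Phi> r :: "'a::euclidean_space \<Rightarrow> ereal"
    and f :: "'a \<Rightarrow> real"
    and fm :: "'a \<Rightarrow> 'a \<Rightarrow> 'w \<Rightarrow> real"
    and S :: "real \<Rightarrow> 'a \<Rightarrow> 'w \<Rightarrow> 'a"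
    and L :: "'w \<Rightarrow> real"
    and \<tau> \<rho> Lbar lam \<alpha> :: real
    and T :: nat
    and \<eta> :: "nat \<Rightarrow> real"
    and x\<^sub>0 :: 'a
    and \<xi> :: "nat \<Rightarrow> 's \<Rightarrow> 'w"
    and tstar :: "'s \<Rightarrow> nat"
  defines "F \<equiv> objective f r"
  assumes setting: "stochastic_model_setting P \<Phi> f r fm S L \<tau> \<rho> Lbar"
    and F_min: "\<exists>x. is_arg_min F (\<lambda>_. True) x"
    and x0: "x\<^sub>0 \<in> interior (edom \<Phi>) \<inter> edom r"
    and lam: "0 < lam" "lam < 1 / (\<tau> + \<rho>)"
    and alpha: "\<alpha> > 0"
    and steps: "\<And>t. t \<le> T \<Longrightarrow> \<eta> t = 1 / (1 / lam + sqrt (real T + 1) / \<alpha>)"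
    and randomness: "algorithm_randomness M P T \<rho> \<eta> \<xi> tstar"
  shows "enn2ereal (\<integral>\<^sup>+ \<omega>. e2ennreal
            (bregman \<Phi> (bregman_prox \<Phi> lam F (returned_point S \<eta> x\<^sub>0 \<xi> tstar \<omega>))
               (returned_point S \<eta> x\<^sub>0 \<xi> tstar \<omega>)) \<partial>M)
         \<le> (ereal (lam\<^sup>2) * (bregman_env \<Phi> lam F x\<^sub>0 - (INF x. F x))
              + ereal (lam * Lbar\<^sup>2 * \<alpha>\<^sup>2 / 4)
              + ereal lam * (r x\<^sub>0 - (INF x. r x)) / ereal (1 / lam - \<rho> + 1 / \<alpha>))
           / ereal (1 - lam * (\<tau> + \<rho>))
           * ereal ((1 / lam - \<rho>) / (real T + 1) + 1 / (\<alpha> * sqrt (real T + 1)))"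
proof -
  interpret stochastic_model_setting P \<Phi> f r fm S L \<tau> \<rho> Lbar by (rule setting)
  define \<eta>\<^sub>0 where "\<eta>\<^sub>0 = 1 / (1 / lam + sqrt (real T + 1) / \<alpha>)"
  have eta: "0 < \<eta>\<^sub>0" "\<eta>\<^sub>0 \<le> lam"
  proof -
    have l: "0 < 1 / lam" using lam by simp
    have sa: "0 < sqrt (real T + 1) / \<alpha>" using alpha by simp
    show "0 < \<eta>\<^sub>0" unfolding \<eta>\<^sub>0_def using l sa by (simp add: add_pos_pos)
    have "1 / (1 / lam + sqrt (real T + 1) / \<alpha>) \<le> 1 / (1 / lam)"
      using l sa by (intro frac_le) auto
    then show "\<eta>\<^sub>0 \<le> lam" by (simp add: \<eta>\<^sub>0_def)
  qed
  have steps': "\<eta> t = \<eta>\<^sub>0" if "t \<le> T" for t using steps[OF that] by (simp add: \<eta>\<^sub>0_def)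
  have q: "lam * (\<tau> + \<rho>) < 1"
    using lam constants_pos by (simp add: field_simps)
  have lr: "\<rho> < 1 / lam"
  proof -
    have "0 < lam * \<tau>" using lam constants_pos by simp
    then have "\<rho> * lam < 1" using q unfolding distrib_left mult.commute[of \<rho>] by linarith
    then show ?thesis using lam by (simp add: field_simps)
  qed
  have K1: "0 < 1 / lam - \<rho> + 1 / \<alpha>" using lr alpha by (simp add: add_pos_pos)
  have K: "0 < (1 / lam - \<rho>) / (real T + 1) + 1 / (\<alpha> * sqrt (real T + 1))"
    using lr alpha by (intro add_pos_pos) auto
  obtain rx where rx: "r x\<^sub>0 = ereal rx"
    using x0 r_not_MInf[of x\<^sub>0] by (cases "r x\<^sub>0") (auto simp: edom_def)
  obtain xs where xs: "\<And>y. F xs \<le> F y"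
    using F_min by (auto simp: is_arg_min_linorder)
  have "F xs \<le> F x\<^sub>0" by (rule xs)
  moreover have "F x\<^sub>0 < \<infinity>" by (simp add: F_def objective_def rx)
  moreover have "F xs \<noteq> -\<infinity>" using r_not_MInf[of xs] by (cases "r xs") (auto simp: F_def objective_def)
  ultimately obtain m where m: "F xs = ereal m" by (cases "F xs") auto
  have infF: "(INF x. F x) = ereal m"
    unfolding m[symmetric] by (intro antisym INF_lower INF_greatest xs) auto
  show ?thesis
  proof (cases "INF x. r x")
    \<comment> \<open>If \<open>r\<close> is unbounded below, the right-hand side is \<open>\<infinity>\<close>: the envelope term is bounded below,
        so no ambiguous sum arises.\<close>
    case MInf
    have "ereal m \<le> bregman_env \<Phi> lam F x\<^sub>0"
      unfolding bregman_env_def m[symmetric]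
      using xs bregman_nonneg[OF legendre, of x\<^sub>0] x0 lam
      by (intro INF_greatest add_increasing2) auto
    then have "bregman_env \<Phi> lam F x\<^sub>0 - ereal m \<noteq> -\<infinity>"
      by (cases "bregman_env \<Phi> lam F x\<^sub>0") auto
    then have "ereal (lam\<^sup>2) * (bregman_env \<Phi> lam F x\<^sub>0 - ereal m) \<noteq> -\<infinity>"
      using lam by (cases "bregman_env \<Phi> lam F x\<^sub>0 - ereal m") auto
    then show ?thesis
      using K K1 q lam unfolding infF MInf rx
      by (cases "ereal (lam\<^sup>2) * (bregman_env \<Phi> lam F x\<^sub>0 - ereal m)") auto
  next
    case PInf
    moreover have "(INF x. r x) \<le> r x\<^sub>0" by (rule INF_lower) simp
    ultimately show ?thesis using rx by simp
  next
    case (real rinf)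
    have rinf: "ereal rinf \<le> r x" for x unfolding real[symmetric] by (rule INF_lower) simp
    have m': "ereal m \<le> objective f r x" for x using xs[of x] unfolding m unfolding F_def .
    interpret proximal_step P \<Phi> r f fm S L \<tau> \<rho> Lbar lam \<eta>\<^sub>0 m rinf x\<^sub>0
      by unfold_locales (use lam eta m' rinf x0 in auto)
    \<comment> \<open>\<open>Q\<close> is the joint law of the samples, \<open>h n\<close> the divergence at the \<open>n\<close>-th iterate of a run.\<close>
    define Q where "Q = PiM {..T} (\<lambda>_. P)"
    define h where "h = (\<lambda>n w. ennreal (D (prox (model_iterate S \<eta> x\<^sub>0 w n)) (model_iterate S \<eta> x\<^sub>0 w n)))"
    define X where "X = (\<lambda>\<omega>. \<lambda>t\<in>{..T}. \<xi> t \<omega>)"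
    define N where "N = real T + 1"
    have N: "0 < N" by (simp add: N_def)
    have hm: "h n \<in> borel_measurable Q" if "n \<le> T" for n
      unfolding h_def Q_def using that
      by (intro measurable_compose[OF iterate_measurable] measurable_compose[OF D_prox_measurable]
            measurable_ennreal steps') auto
    interpret M: prob_space M using randomness by (simp add: algorithm_randomness_def)
    have step0: "\<eta>\<^sub>0 / (1 - \<eta>\<^sub>0 * \<rho>) \<noteq> 0"
    proof -
      have "\<eta>\<^sub>0 * \<rho> \<le> lam * \<rho>" using eta constants_pos by simp
      also have "\<dots> < 1" using lr lam by (simp add: field_simps)
      finally show ?thesis using eta by simp
    qed
    have wsum: "(\<Sum>t\<le>T. \<eta> t / (1 - \<eta> t * \<rho>)) = N * (\<eta>\<^sub>0 / (1 - \<eta>\<^sub>0 * \<rho>))"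
      using steps' by (simp add: N_def)
    \<comment> \<open>Constant steps make the sampling weights uniform.\<close>
    have w1: "(\<eta> n / (1 - \<eta> n * \<rho>)) / (\<Sum>t\<le>T. \<eta> t / (1 - \<eta> t * \<rho>)) = 1 / N" if "n \<le> T" for n
      unfolding wsum using steps'[OF that] step0 N by simp
    have w0: "(\<Sum>t\<le>T. \<eta> t / (1 - \<eta> t * \<rho>)) \<noteq> 0"
      unfolding wsum using step0 N by simp
    have law: "(\<integral>\<^sup>+\<omega>. h (tstar \<omega>) (X \<omega>) \<partial>M) = ennreal (1 / N) * (\<Sum>n\<le>T. \<integral>\<^sup>+w. h n w \<partial>Q)"
      using nn_integral_random_index[OF randomness w0 hm[unfolded Q_def]] w1
      unfolding X_def Q_def by (simp add: sum_distrib_left)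
    define E where "E = (\<integral>\<^sup>+\<omega>. e2ennreal (bregman \<Phi> (prox (returned_point S \<eta> x\<^sub>0 \<xi> tstar \<omega>))
               (returned_point S \<eta> x\<^sub>0 \<xi> tstar \<omega>)) \<partial>M)"
    have E: "E = (\<integral>\<^sup>+\<omega>. h (tstar \<omega>) (X \<omega>) \<partial>M)"
      unfolding E_def
    proof (rule nn_integral_cong_AE)
      have "\<xi> t \<in> M \<rightarrow>\<^sub>M P" if "t \<le> T" for t
        using randomness that unfolding algorithm_randomness_def M.indep_vars_def2 by blast
      then have Xm: "X \<in> M \<rightarrow>\<^sub>M PiM {..T} (\<lambda>_. P)"
        unfolding X_def by (intro measurable_restrict) auto
      show "AE \<omega> in M. e2ennreal (bregman \<Phi> (prox (returned_point S \<eta> x\<^sub>0 \<xi> tstar \<omega>))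
               (returned_point S \<eta> x\<^sub>0 \<xi> tstar \<omega>)) = h (tstar \<omega>) (X \<omega>)"
        using tstar_le[OF randomness w0] AE_space
      proof eventually_elim
        fix \<omega> assume t: "tstar \<omega> \<le> T" and "\<omega> \<in> space M"
        then have XQ: "X \<omega> \<in> space (PiM {..T} (\<lambda>_. P))"
          using measurable_space[OF Xm] by blast
        have eq: "returned_point S \<eta> x\<^sub>0 \<xi> tstar \<omega> = model_iterate S \<eta> x\<^sub>0 (X \<omega>) (tstar \<omega>)"
          unfolding returned_point_def X_def by (rule model_iterate_cong) (use t in simp)
        have "model_iterate S \<eta> x\<^sub>0 (X \<omega>) (tstar \<omega>) \<in> U"
          using t by (intro iterate_in_U[OF _ _ XQ] steps') auto
        then show "e2ennreal (bregman \<Phi> (prox (returned_point S \<eta> x\<^sub>0 \<xi> tstar \<omega>))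
               (returned_point S \<eta> x\<^sub>0 \<xi> tstar \<omega>)) = h (tstar \<omega>) (X \<omega>)"
          unfolding eq h_def by (simp add: bregman_U prox_U)
      qed
    qed
    define R where "R = (potential x\<^sub>0 + N * (\<gamma> / lam * (\<eta>\<^sub>0 * Lbar\<^sup>2 / 4))) / (N * \<kappa>)"
    have sum: "ennreal \<kappa> * (\<Sum>n\<le>T. \<integral>\<^sup>+w. h n w \<partial>Q) \<le> ennreal (R * (N * \<kappa>))"
      using sum_divergence_le[of T \<eta>, OF steps'] N kappa_pos
      by (simp add: h_def Q_def R_def N_def add.commute)
    have "E = ennreal (1 / (N * \<kappa>)) * (ennreal \<kappa> * (\<Sum>n\<le>T. \<integral>\<^sup>+w. h n w \<partial>Q))"
      unfolding E law mult.assoc[symmetric] using N kappa_pos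
      by (simp flip: ennreal_mult)
    also have "\<dots> \<le> ennreal (1 / (N * \<kappa>)) * ennreal (R * (N * \<kappa>))"
      using sum by (rule mult_left_mono) simp
    also have "\<dots> = ennreal R"
      using N kappa_pos by (subst ennreal_mult'[symmetric]) auto
    finally have ER: "E \<le> ennreal R" .
    have R0: "0 \<le> R"
      unfolding R_def using potential_nonneg[of x\<^sub>0] x0 N kappa_pos gamma_pos lam eta by simp
    have rx': "rinf \<le> rx" using rinf[of x\<^sub>0] rx by simp
    have rrx: "rr x\<^sub>0 = rx" by (simp add: rx)
    have "R \<le> (lam\<^sup>2 * (env x\<^sub>0 - m) + lam * Lbar\<^sup>2 * \<alpha>\<^sup>2 / 4 + lam * (rx - rinf) / (1 / lam - \<rho> + 1 / \<alpha>))
        / (1 - lam * (\<tau> + \<rho>)) * ((1 / lam - \<rho>) / (real T + 1) + 1 / (\<alpha> * sqrt (real T + 1)))"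
      unfolding R_def potential_def rrx \<kappa>_def \<gamma>_def N_def unfolding \<eta>\<^sub>0_def
      by (rule rate_arithmetic[OF lam(1) alpha constants_pos(1,2) q]) (simp add: rx')
    then have "ereal R \<le> (ereal (lam\<^sup>2) * (ereal (env x\<^sub>0) - ereal m) + ereal (lam * Lbar\<^sup>2 * \<alpha>\<^sup>2 / 4)
          + ereal lam * (ereal rx - ereal rinf) / ereal (1 / lam - \<rho> + 1 / \<alpha>))
        / ereal (1 - lam * (\<tau> + \<rho>)) * ereal ((1 / lam - \<rho>) / (real T + 1) + 1 / (\<alpha> * sqrt (real T + 1)))"
      using K1 q by (subst ereal_quotient_arithmetic) auto
    note bound = this
    have ER': "enn2ereal E \<le> ereal R"
      using ER R0 unfolding less_eq_ennreal.rep_eq by (simp add: enn2ereal_ennreal)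
    have env0: "bregman_env \<Phi> lam F x\<^sub>0 = ereal (env x\<^sub>0)"
      unfolding F_def using x0 by (intro bregman_env_eq) simp
    show ?thesis
      unfolding infF real rx env0
      by (rule order_trans[OF ER'[unfolded E_def, folded F_def] bound])
  qed
qed

end
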